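(* The entropy $$H(\xi(\cdot|D)) = -\sum_{T\in\mathcal{T}}\xi(T|D)\log \xi(T|D)$$ of the posterior distribution $\xi(\cdot|D)$ on the set $\mathcal{T}$ of spanning trees on $p$ vertices can be computed, from the $p\times p$ weight matrix $\omega$, with complexity $O(p^3)$.
   Context: Let $V = \{1,\dots,p\}$, let $\mathcal{T}$ be the set of spanning trees on $V$ (connected acyclic undirected graphs with vertex set $V$), and write $E_T$ for the edge set of $T\in\mathcal{T}$. The posterior distribution on trees is $\xi(T|D) = \frac{1}{Z}\prod_{\{i,j\}\in E_T}\omega_{ij}$ for $T\in\mathcal{T}$, where $Z = \sum_{T\in\mathcal{T}}\prod_{\{i,j\}\in E_T}\omega_{ij}$ and $\omega = (\omega_{ij})_{i,j\in V}$ is a known symmetric matrix with zero diagonal and non-negative off-diagonal entries (depending on the data $D$) such that the graph on $V$ with edge set $\{\{i,j\} : i\neq j,\ \omega_{ij} > 0\}$ is connected. Conventions: $0\log 0 = 0$. Complexity is counted as the number of elementary operations on real numbers (arithmetic operations, comparisons and evaluations of $\log$, each at unit cost), as a function of $p$. *)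

theory Defs
  imports Complex_Main "HOL-Library.Landau_Symbols"
begin

section \<open>Spanning trees and the posterior\<close>

text \<open>
  An undirected simple graph on a vertex set is given by its edge set, each edge being a
  two-element set of vertices.
\<close>

definition vertices :: "nat \<Rightarrow> nat set" where
  "vertices p = {1..p}"

definition all_edges :: "nat set \<Rightarrow> nat set set" where
  "all_edges V = {{i, j} | i j. i \<in> V \<and> j \<in> V \<and> i \<noteq> j}"

definition connected_graph :: "nat set \<Rightarrow> nat set set \<Rightarrow> bool" where
  "connected_graph V E \<longleftrightarrow> (\<forall>u\<in>V. \<forall>v\<in>V. (u, v) \<in> {(a, b). {a, b} \<in> E}\<^sup>*)"

definition graph_cycle :: "nat set set \<Rightarrow> nat list \<Rightarrow> bool" where
  "graph_cycle E xs \<longleftrightarrow> 3 \<le> length xs \<and> distinct xs \<and>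
     (\<forall>k < length xs. {xs ! k, xs ! ((k + 1) mod length xs)} \<in> E)"

definition acyclic_graph :: "nat set set \<Rightarrow> bool" where
  "acyclic_graph E \<longleftrightarrow> (\<nexists>xs. graph_cycle E xs)"

definition spanning_trees :: "nat \<Rightarrow> nat set set set" where
  "spanning_trees p = {E. E \<subseteq> all_edges (vertices p) \<and>
     connected_graph (vertices p) E \<and> acyclic_graph E}"

text \<open>
  The matrix entries are used at indices in \<^term>\<open>vertices p\<close> only.
\<close>

definition weight_matrix :: "nat \<Rightarrow> (nat \<Rightarrow> nat \<Rightarrow> real) \<Rightarrow> bool" where
  "weight_matrix p \<omega> \<longleftrightarrow>
     (\<forall>i\<in>vertices p. \<forall>j\<in>vertices p. \<omega> i j = \<omega> j i) \<and>
     (\<forall>i\<in>vertices p. \<omega> i i = 0) \<and>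
     (\<forall>i\<in>vertices p. \<forall>j\<in>vertices p. i \<noteq> j \<longrightarrow> 0 \<le> \<omega> i j) \<and>
     connected_graph (vertices p)
       {{i, j} | i j. i \<in> vertices p \<and> j \<in> vertices p \<and> i \<noteq> j \<and> 0 < \<omega> i j}"

text \<open>
  For a symmetric matrix this is the entry \<open>\<omega> i j\<close> of the edge \<open>e = {i, j}\<close>, whichever end
  comes first.
\<close>

definition edge_weight :: "(nat \<Rightarrow> nat \<Rightarrow> real) \<Rightarrow> nat set \<Rightarrow> real" where
  "edge_weight \<omega> e = \<omega> (Min e) (Max e)"

lemma edge_weight_doubleton:
  assumes "weight_matrix p \<omega>" "i \<in> vertices p" "j \<in> vertices p"
  shows "edge_weight \<omega> {i, j} = \<omega> i j"
  using assms by (cases i j rule: linorder_cases)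
    (auto simp: edge_weight_def weight_matrix_def min_def max_def)

definition tree_weight :: "(nat \<Rightarrow> nat \<Rightarrow> real) \<Rightarrow> nat set set \<Rightarrow> real" where
  "tree_weight \<omega> E = (\<Prod>e\<in>E. edge_weight \<omega> e)"

definition partition_function :: "nat \<Rightarrow> (nat \<Rightarrow> nat \<Rightarrow> real) \<Rightarrow> real" where
  "partition_function p \<omega> = (\<Sum>E\<in>spanning_trees p. tree_weight \<omega> E)"

definition posterior :: "nat \<Rightarrow> (nat \<Rightarrow> nat \<Rightarrow> real) \<Rightarrow> nat set set \<Rightarrow> real" where
  "posterior p \<omega> E = tree_weight \<omega> E / partition_function p \<omega>"

text \<open>
  The convention \<open>0 log 0 = 0\<close> is written out, although it also follows from the library's
  treatment of products with zero.
\<close>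

definition posterior_entropy :: "nat \<Rightarrow> (nat \<Rightarrow> nat \<Rightarrow> real) \<Rightarrow> real" where
  "posterior_entropy p \<omega> = - (\<Sum>E\<in>spanning_trees p.
     if posterior p \<omega> E = 0 then 0 else posterior p \<omega> E * ln (posterior p \<omega> E))"


section \<open>Computation over the reals\<close>

text \<open>
  A uniform model: a program is one finite object that has to work for every \<open>p\<close>. A state
  consists of natural-number variables, used for loop control and addressing, and of named
  two-dimensional arrays of reals. No instruction turns a number of one sort into one of the
  other; real data act on the indices only through the outcome of comparisons.
\<close>

datatype index_exp =
    INum nat
  | IVar string
  | IAdd index_exp index_exp
  | ISub index_exp index_exp
  | IMul index_exp index_exp

datatype real_exp =
    RNum int
  | RCell string index_exp index_exp
  | RAdd real_exp real_exp
  | RSub real_exp real_exp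
  | RMul real_exp real_exp
  | RDiv real_exp real_exp
  | RLog real_exp

datatype test =
    ILess index_exp index_exp
  | RLess real_exp real_exp

datatype com =
    Skip
  | IAssign string index_exp
  | RAssign string index_exp index_exp real_exp
  | Seq com com
  | Cond test com com
  | While test com

type_synonym state = "(string \<Rightarrow> nat) \<times> (string \<Rightarrow> nat \<Rightarrow> nat \<Rightarrow> real)"

primrec ival :: "index_exp \<Rightarrow> state \<Rightarrow> nat" where
  "ival (INum n) s = n"
| "ival (IVar x) s = fst s x"
| "ival (IAdd a b) s = ival a s + ival b s"
| "ival (ISub a b) s = ival a s - ival b s"
| "ival (IMul a b) s = ival a s * ival b s"

primrec rval :: "real_exp \<Rightarrow> state \<Rightarrow> real" where
  "rval (RNum n) s = of_int n"
| "rval (RCell A i j) s = snd s A (ival i s) (ival j s)"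
| "rval (RAdd a b) s = rval a s + rval b s"
| "rval (RSub a b) s = rval a s - rval b s"
| "rval (RMul a b) s = rval a s * rval b s"
| "rval (RDiv a b) s = rval a s / rval b s"
| "rval (RLog a) s = ln (rval a s)"

text \<open>
  Division by zero and the logarithm of a non-positive number are errors: a program that
  attempts them has no execution, so it cannot exploit the library's values there.
\<close>

primrec rdefined :: "real_exp \<Rightarrow> state \<Rightarrow> bool" where
  "rdefined (RNum n) s = True"
| "rdefined (RCell A i j) s = True"
| "rdefined (RAdd a b) s = (rdefined a s \<and> rdefined b s)"
| "rdefined (RSub a b) s = (rdefined a s \<and> rdefined b s)"
| "rdefined (RMul a b) s = (rdefined a s \<and> rdefined b s)"
| "rdefined (RDiv a b) s = (rdefined a s \<and> rdefined b s \<and> rval b s \<noteq> 0)"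
| "rdefined (RLog a) s = (rdefined a s \<and> 0 < rval a s)"

text \<open>
  Unit cost for each arithmetic operation, logarithm and comparison of reals; index
  computations and data movement are not operations on reals.
\<close>

primrec rcost :: "real_exp \<Rightarrow> nat" where
  "rcost (RNum n) = 0"
| "rcost (RCell A i j) = 0"
| "rcost (RAdd a b) = rcost a + rcost b + 1"
| "rcost (RSub a b) = rcost a + rcost b + 1"
| "rcost (RMul a b) = rcost a + rcost b + 1"
| "rcost (RDiv a b) = rcost a + rcost b + 1"
| "rcost (RLog a) = rcost a + 1"

primrec tval :: "test \<Rightarrow> state \<Rightarrow> bool" where
  "tval (ILess a b) s = (ival a s < ival b s)"
| "tval (RLess a b) s = (rval a s < rval b s)"

primrec tdefined :: "test \<Rightarrow> state \<Rightarrow> bool" where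
  "tdefined (ILess a b) s = True"
| "tdefined (RLess a b) s = (rdefined a s \<and> rdefined b s)"

primrec tcost :: "test \<Rightarrow> nat" where
  "tcost (ILess a b) = 0"
| "tcost (RLess a b) = rcost a + rcost b + 1"

definition iupdate :: "string \<Rightarrow> nat \<Rightarrow> state \<Rightarrow> state" where
  "iupdate x n s = ((fst s)(x := n), snd s)"

definition rupdate :: "string \<Rightarrow> nat \<Rightarrow> nat \<Rightarrow> real \<Rightarrow> state \<Rightarrow> state" where
  "rupdate A m n r s = (fst s, (snd s)(A := (snd s A)(m := (snd s A m)(n := r))))"

text \<open>
  \<open>exec c s n t\<close>: started in state \<open>s\<close>, the program \<open>c\<close> terminates without error in state
  \<open>t\<close> after exactly \<open>n\<close> elementary operations on reals.
\<close>

inductive exec :: "com \<Rightarrow> state \<Rightarrow> nat \<Rightarrow> state \<Rightarrow> bool" where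
  Skip: "exec Skip s 0 s"
| IAssign: "exec (IAssign x a) s 0 (iupdate x (ival a s) s)"
| RAssign: "rdefined e s \<Longrightarrow>
    exec (RAssign A i j e) s (rcost e) (rupdate A (ival i s) (ival j s) (rval e s) s)"
| Seq: "exec c1 s m t \<Longrightarrow> exec c2 t n u \<Longrightarrow> exec (Seq c1 c2) s (m + n) u"
| CondTrue: "tdefined b s \<Longrightarrow> tval b s \<Longrightarrow> exec c1 s n t \<Longrightarrow>
    exec (Cond b c1 c2) s (tcost b + n) t"
| CondFalse: "tdefined b s \<Longrightarrow> \<not> tval b s \<Longrightarrow> exec c2 s n t \<Longrightarrow>
    exec (Cond b c1 c2) s (tcost b + n) t"
| WhileFalse: "tdefined b s \<Longrightarrow> \<not> tval b s \<Longrightarrow> exec (While b c) s (tcost b) s"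
| WhileTrue: "tdefined b s \<Longrightarrow> tval b s \<Longrightarrow> exec c s m t \<Longrightarrow>
    exec (While b c) t n u \<Longrightarrow> exec (While b c) s (tcost b + m + n) u"

inductive_cases SkipE: "exec Skip s n t"
  and IAssignE: "exec (IAssign x a) s n t"
  and RAssignE: "exec (RAssign A i j e) s n t"
  and SeqE: "exec (Seq c1 c2) s n t"
  and CondE: "exec (Cond b c1 c2) s n t"
  and WhileE: "exec (While b c) s n t"

lemma exec_deterministic:
  assumes "exec c s n t" "exec c s n' t'"
  shows "n = n' \<and> t = t'"
  using assms
proof (induction arbitrary: n' t' rule: exec.induct)
  case (Seq c1 s m t c2 n u)
  from Seq.prems show ?case by (rule SeqE) (use Seq.IH in blast)
next
  case (CondTrue b s c1 n t c2)
  from CondTrue.prems show ?case by (rule CondE) (use CondTrue in blast)+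
next
  case (CondFalse b s c2 n t c1)
  from CondFalse.prems show ?case by (rule CondE) (use CondFalse in blast)+
next
  case (WhileTrue b s c m t n u)
  from WhileTrue.prems show ?case by (rule WhileE) (use WhileTrue in blast)+
qed (auto elim: SkipE IAssignE RAssignE WhileE)

text \<open>
  All a program is given is \<open>p\<close>, in the index variable \<open>p\<close>, and the \<open>p \<times> p\<close> matrix, in the array
  \<open>w\<close>; everything else, including \<open>w\<close> outside the range of the matrix, is zero. The result
  is left in cell \<open>(0, 0)\<close> of the array \<open>out\<close>.
\<close>

definition input_state :: "nat \<Rightarrow> (nat \<Rightarrow> nat \<Rightarrow> real) \<Rightarrow> state" where
  "input_state p \<omega> =
     ((\<lambda>x. if x = ''p'' then p else 0),
      (\<lambda>A i j. if A = ''w'' \<and> i \<in> vertices p \<and> j \<in> vertices p then \<omega> i j else 0))"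

definition result :: "state \<Rightarrow> real" where
  "result s = snd s ''out'' 0 0"

text \<open>
  \<open>computes_with_cost c P f T\<close>: on every \<open>p \<times> p\<close> matrix satisfying \<open>P p\<close>, with \<open>p \<ge> 1\<close>, the
  program \<open>c\<close> returns the exact value of \<open>f p\<close> using at most \<open>T p\<close> operations.
\<close>

definition computes_with_cost ::
  "com \<Rightarrow> (nat \<Rightarrow> (nat \<Rightarrow> nat \<Rightarrow> real) \<Rightarrow> bool) \<Rightarrow> (nat \<Rightarrow> (nat \<Rightarrow> nat \<Rightarrow> real) \<Rightarrow> real) \<Rightarrow>
     (nat \<Rightarrow> nat) \<Rightarrow> bool" where
  "computes_with_cost c P f T \<longleftrightarrow>
     (\<forall>p \<omega>. 1 \<le> p \<longrightarrow> P p \<omega> \<longrightarrow>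
        (\<exists>n s. exec c (input_state p \<omega>) n s \<and> result s = f p \<omega> \<and> n \<le> T p))"

end

theory Submission
  imports Defs
begin

text \<open>
  Eliminate the vertices one at a time by the star-mesh transform: removing a vertex \<open>n\<close> whose edges
  have total weight \<open>s\<close> and adding \<open>w a n * w n b / s\<close> to each remaining weight \<open>w a b\<close> divides the
  tree sum \<open>Z\<close> by \<open>s\<close>. Hence \<open>Z\<close> is the product of the successive star sums, and each elimination
  costs \<open>O(p\<^sup>2)\<close> operations.

  The entropy follows by forward-mode differentiation of this computation. Let \<open>Z(t)\<close> be the tree sum
  of the entrywise powers \<open>\<omega> powr t\<close>. Tree weights are multiplicative, so \<open>Z'(1)\<close> is the sum of
  \<open>x * ln x\<close> over all tree weights \<open>x\<close>, and the entropy is \<open>ln Z(1) - Z'(1) / Z(1)\<close>; carrying the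
  derivatives of all weights along only costs a constant factor.

  The star-mesh identity and Cayley's formula, for edge weights \<open>x a * x b\<close>, are proved by a joint
  induction on the number of vertices. Deletion and contraction of the edges away from \<open>n\<close> reduces the
  star-mesh identity to a star, where it is Cayley's formula with one vertex less; conversely,
  eliminating a vertex in Cayley's formula only rescales the weights.
\<close>

section \<open>Spanning trees and contraction\<close>

abbreviation adj :: "nat set set \<Rightarrow> (nat \<times> nat) set" where
  "adj E \<equiv> {(a, b). {a, b} \<in> E}"

lemma adj_rtrancl_sym: "(a, b) \<in> (adj E)\<^sup>* \<Longrightarrow> (b, a) \<in> (adj E)\<^sup>*"
proof -
  have "sym (adj E)" by (auto simp: sym_def insert_commute)
  then show "(a, b) \<in> (adj E)\<^sup>* \<Longrightarrow> (b, a) \<in> (adj E)\<^sup>*" by (meson sym_rtrancl symD)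
qed

lemma adj_rtrancl_mono: "E \<subseteq> F \<Longrightarrow> (a, b) \<in> (adj E)\<^sup>* \<Longrightarrow> (a, b) \<in> (adj F)\<^sup>*"
  by (rule rtrancl_mono[THEN subsetD, rotated]) auto

lemma connected_graph_mono: "connected_graph V E \<Longrightarrow> E \<subseteq> F \<Longrightarrow> connected_graph V F"
  unfolding connected_graph_def by (blast intro: adj_rtrancl_mono)

lemma in_all_edgesE:
  assumes "e \<in> all_edges V"
  obtains a b where "e = {a, b}" "a \<in> V" "b \<in> V" "a \<noteq> b"
  using assms unfolding all_edges_def by blast

lemma in_all_edges_atE:
  assumes "e \<in> all_edges V" "a \<in> e"
  obtains b where "e = {a, b}" "a \<in> V" "b \<in> V" "b \<noteq> a"
proof -
  obtain x y where xy: "e = {x, y}" "x \<in> V" "y \<in> V" "x \<noteq> y" using assms(1) by (rule in_all_edgesE)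
  show ?thesis
  proof (cases "a = x")
    case True
    then show ?thesis using that[of y] xy by simp
  next
    case False
    then have "a = y" using assms(2) xy by simp
    then show ?thesis using that[of x] xy by (simp add: insert_commute)
  qed
qed

lemma doubleton_in_all_edges: "{a, b} \<in> all_edges V \<longleftrightarrow> a \<in> V \<and> b \<in> V \<and> a \<noteq> b"
  unfolding all_edges_def by (auto simp: doubleton_eq_iff)

lemma all_edges_subset_Pow: "all_edges V \<subseteq> Pow V"
  unfolding all_edges_def by auto

lemma finite_all_edges: "finite V \<Longrightarrow> finite (all_edges V)"
  using all_edges_subset_Pow finite_subset by blast

section \<open>Redundant edges, cycles and bridges\<close>

lemma connected_graph_remove_edge:
  assumes "connected_graph V E" "(u, v) \<in> (adj (E - {{u, v}}))\<^sup>*"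
  shows "connected_graph V (E - {{u, v}})"
proof -
  let ?F = "E - {{u, v}}"
  have "adj E \<subseteq> (adj ?F)\<^sup>*"
  proof safe
    fix a b assume ab: "{a, b} \<in> E"
    show "(a, b) \<in> (adj ?F)\<^sup>*"
    proof (cases "{a, b} = {u, v}")
      case True
      then show ?thesis using assms(2) adj_rtrancl_sym[OF assms(2)] by (auto simp: doubleton_eq_iff)
    next
      case False
      with ab show ?thesis by blast
    qed
  qed
  then have "(adj E)\<^sup>* \<subseteq> (adj ?F)\<^sup>*" by (metis rtrancl_mono rtrancl_idemp)
  then show ?thesis using assms(1) unfolding connected_graph_def by blast
qed

text \<open>The edge to drop is the one that closes the cycle, between its last and first vertex:
  the rest of the cycle still joins these two.\<close>

lemma cycle_edge_redundant:
  assumes "connected_graph V E" "graph_cycle E xs"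
  obtains e where "e \<in> E" "connected_graph V (E - {e})"
proof -
  let ?n = "length xs"
  let ?e = "{xs ! 0, xs ! (?n - 1)}"
  have n: "3 \<le> ?n" and d: "distinct xs"
    and ed: "\<And>k. k < ?n \<Longrightarrow> {xs ! k, xs ! ((k + 1) mod ?n)} \<in> E"
    using assms(2) unfolding graph_cycle_def by auto
  have e: "?e \<in> E"
  proof -
    have "?n - 1 + 1 = ?n" using n by simp
    then have "(?n - 1 + 1) mod ?n = 0" by (simp only: mod_self)
    then show ?thesis using ed[of "?n - 1"] n by (metis insert_commute diff_less less_numeral_extra(1) not_numeral_le_zero neq0_conv)
  qed
  have path: "(xs ! 0, xs ! k) \<in> (adj (E - {?e}))\<^sup>*" if "k < ?n" for k
    using that
  proof (induction k)
    case (Suc k)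
    have "{xs ! k, xs ! Suc k} \<in> E"
      using ed[of k] Suc.prems by simp
    \<comment> \<open>By distinctness an edge along the path could equal the closing edge only if
      \<open>k = 0\<close> and \<open>Suc k = length xs - 1\<close>, that is, for a cycle of length
      two.\<close>
    moreover have "{xs ! k, xs ! Suc k} \<noteq> ?e"
    proof -
      have "xs ! Suc k \<noteq> xs ! 0"
        by (subst nth_eq_iff_index_eq[OF d]) (use Suc.prems in linarith)+
      moreover have "xs ! k = xs ! 0 \<longleftrightarrow> k = 0"
        by (rule nth_eq_iff_index_eq[OF d]) (use Suc.prems in linarith)+
      moreover have "xs ! Suc k = xs ! (?n - 1) \<longleftrightarrow> Suc k = ?n - 1"
        by (rule nth_eq_iff_index_eq[OF d]) (use Suc.prems in linarith)+
      ultimately show ?thesis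
        unfolding doubleton_eq_iff using n by linarith
    qed
    ultimately have "(xs ! k, xs ! Suc k) \<in> adj (E - {?e})" by blast
    then show ?case using Suc by (meson Suc_lessD rtrancl.rtrancl_into_rtrancl)
  qed simp
  have "connected_graph V (E - {?e})"
    by (rule connected_graph_remove_edge[OF assms(1)]) (use path[of "?n - 1"] n in auto)
  with e that show ?thesis by blast
qed

text \<open>Whenever a walk returns to a vertex that it has visited, it is cut back to that
  visit.\<close>

lemma rtrancl_adj_distinct_path:
  assumes "(u, v) \<in> (adj E)\<^sup>*"
  shows "\<exists>xs. distinct xs \<and> xs \<noteq> [] \<and> hd xs = u \<and> last xs = v \<and>
    successively (\<lambda>a b. {a, b} \<in> E) xs"
  using assms
proof (induction rule: rtrancl_induct)
  case base
  show ?case by (intro exI[of _ "[u]"]) auto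
next
  case (step y z)
  then obtain xs where xs: "distinct xs" "xs \<noteq> []" "hd xs = u" "last xs = y"
    "successively (\<lambda>a b. {a, b} \<in> E) xs" by blast
  show ?case
  proof (cases "z \<in> set xs")
    case True
    then obtain ys zs where yz: "xs = ys @ z # zs" by (meson split_list)
    have "distinct (ys @ [z])" "hd (ys @ [z]) = u"
      "successively (\<lambda>a b. {a, b} \<in> E) (ys @ [z])"
      using xs yz by (auto simp: successively_append_iff hd_append split: if_splits)
    then show ?thesis by (intro exI[of _ "ys @ [z]"]) auto
  next
    case False
    then have "distinct (xs @ [z])" "hd (xs @ [z]) = u"
      "successively (\<lambda>a b. {a, b} \<in> E) (xs @ [z])"
      using xs step(2) by (auto simp: successively_append_iff)
    then show ?thesis by (intro exI[of _ "xs @ [z]"]) auto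
  qed
qed

text \<open>A simple path from \<open>u\<close> to \<open>v\<close> that avoids the edge
  \<open>{u, v}\<close> would close up with it to a cycle. The path has at least three vertices,
  since its ends differ and a path on two vertices would be the excluded edge.\<close>

lemma acyclic_edge_bridge:
  assumes "acyclic_graph E" "{u, v} \<in> E" "u \<noteq> v"
  shows "(u, v) \<notin> (adj (E - {{u, v}}))\<^sup>*"
proof
  assume "(u, v) \<in> (adj (E - {{u, v}}))\<^sup>*"
  then obtain xs where xs: "distinct xs" "xs \<noteq> []" "hd xs = u" "last xs = v"
    "successively (\<lambda>a b. {a, b} \<in> E - {{u, v}}) xs"
    using rtrancl_adj_distinct_path by blast
  have nth0: "xs ! 0 = u" and nthl: "xs ! (length xs - 1) = v"
    using xs by (auto simp: hd_conv_nth last_conv_nth)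
  have step: "{xs ! k, xs ! Suc k} \<in> E - {{u, v}}" if "Suc k < length xs" for k
    using xs(5) that by (simp add: successively_conv_nth)
  have "length xs \<noteq> 1" using nth0 nthl assms(3) by auto
  moreover have "length xs \<noteq> 2" using nth0 nthl step[of 0] by auto
  ultimately have len: "3 \<le> length xs" using xs(2) by (cases "length xs") auto
  have "graph_cycle E xs"
    unfolding graph_cycle_def
  proof (intro conjI allI impI)
    fix k assume k: "k < length xs"
    show "{xs ! k, xs ! ((k + 1) mod length xs)} \<in> E"
    proof (cases "Suc k < length xs")
      case True
      with step[of k] show ?thesis by simp
    next
      case False
      with k have k': "k + 1 = length xs" by simp
      then have "k = length xs - 1" "(k + 1) mod length xs = 0" by (simp, simp only: k' mod_self)
      then show ?thesis using nth0 nthl assms(2) by (simp add: insert_commute)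
    qed
  qed (use len xs(1) in auto)
  then show False using assms(1) unfolding acyclic_graph_def by blast
qed

section \<open>Merging two vertices\<close>

definition merge :: "nat \<Rightarrow> nat \<Rightarrow> nat \<Rightarrow> nat" where
  "merge i j x = (if x = j then i else x)"

lemma merge_edge:
  assumes "i \<in> V" "i \<noteq> j" "f \<in> all_edges V" "f \<noteq> {i, j}"
  shows "merge i j ` f \<in> all_edges (V - {j})"
  using assms(3)
proof (rule in_all_edgesE)
  fix a b assume ab: "f = {a, b}" "a \<in> V" "b \<in> V" "a \<noteq> b"
  then have "merge i j ` f = {merge i j a, merge i j b}" by simp
  moreover have "merge i j a \<noteq> merge i j b" "merge i j a \<in> V - {j}" "merge i j b \<in> V - {j}"
    using ab assms by (auto simp: merge_def doubleton_eq_iff)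
  ultimately show ?thesis by (simp add: doubleton_in_all_edges)
qed

text \<open>Merging sends each edge to an edge, or collapses it if it is \<open>{i, j}\<close>, so
  walks descend. Conversely the edge \<open>{i, j}\<close> joins every vertex to its image under the
  merge, so each edge of the merged graph lifts to a walk.\<close>

lemma connected_graph_contract:
  assumes "i \<in> V" "j \<in> V" "i \<noteq> j" "F \<subseteq> all_edges V"
  shows "connected_graph V (insert {i, j} F) \<longleftrightarrow>
    connected_graph (V - {j}) ((`) (merge i j) ` F)"
proof -
  let ?m = "merge i j" and ?E = "insert {i, j} F"
  let ?G = "(`) (merge i j) ` F"
  have "connected_graph (V - {j}) ?G" if con: "connected_graph V ?E"
  proof -
    have adj_step: "(?m a, ?m b) \<in> (adj ?G)\<^sup>*" if "(a, b) \<in> adj ?E" for a b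
    proof (cases "{a, b} = {i, j}")
      case True
      then have "?m a = ?m b" by (auto simp: merge_def doubleton_eq_iff)
      then show ?thesis by simp
    next
      case False
      then have "?m ` {a, b} \<in> ?G" using that by blast
      then show ?thesis by auto
    qed
    have *: "(?m a, ?m b) \<in> (adj ?G)\<^sup>*" if "(a, b) \<in> (adj ?E)\<^sup>*" for a b
      using that
    proof (induction rule: rtrancl_induct)
      case (step y z)
      show ?case by (rule rtrancl_trans[OF step(3) adj_step[OF step(2)]])
    qed simp
    show ?thesis
      unfolding connected_graph_def
    proof (intro ballI)
      fix u v assume uv: "u \<in> V - {j}" "v \<in> V - {j}"
      then have "(u, v) \<in> (adj ?E)\<^sup>*" using con unfolding connected_graph_def by blast
      from *[OF this] uv show "(u, v) \<in> (adj ?G)\<^sup>*" by (simp add: merge_def)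
    qed
  qed
  moreover have "connected_graph V ?E" if con: "connected_graph (V - {j}) ?G"
  proof -
    have m1: "(?m x, x) \<in> (adj ?E)\<^sup>*" for x
      by (cases "x = j") (simp_all add: merge_def r_into_rtrancl)
    have m2: "(x, ?m x) \<in> (adj ?E)\<^sup>*" for x using adj_rtrancl_sym[OF m1[of x]] .
    have mm: "(?m x, ?m y) \<in> (adj ?E)\<^sup>*" if "{x, y} \<in> F" for x y
    proof -
      have "(x, y) \<in> (adj ?E)\<^sup>*" using that by (intro r_into_rtrancl) simp
      then show ?thesis using m1[of x] m2[of y] by (meson rtrancl_trans)
    qed
    have "adj ?G \<subseteq> (adj ?E)\<^sup>*"
    proof (rule subrelI)
      fix a b assume "(a, b) \<in> adj ?G"
      then obtain f where f: "{a, b} = ?m ` f" "f \<in> F" by blast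
      then obtain x y where xy: "f = {x, y}" using in_all_edgesE[OF subsetD[OF assms(4) f(2)]] by metis
      with f have "(a = ?m x \<and> b = ?m y) \<or> (a = ?m y \<and> b = ?m x)"
        by (simp add: doubleton_eq_iff)
      moreover have "{x, y} \<in> F" "{y, x} \<in> F" using f(2) xy by (simp_all add: insert_commute)
      ultimately show "(a, b) \<in> (adj ?E)\<^sup>*" using mm by blast
    qed
    then have sub: "(adj ?G)\<^sup>* \<subseteq> (adj ?E)\<^sup>*" by (metis rtrancl_mono rtrancl_idemp)
    show ?thesis
      unfolding connected_graph_def
    proof (intro ballI)
      fix u v assume uv: "u \<in> V" "v \<in> V"
      have "?m u \<in> V - {j}" "?m v \<in> V - {j}" using uv assms by (simp_all add: merge_def)
      then have "(?m u, ?m v) \<in> (adj ?G)\<^sup>*" using con unfolding connected_graph_def by blast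
      then have "(?m u, ?m v) \<in> (adj ?E)\<^sup>*" using sub by blast
      then show "(u, v) \<in> (adj ?E)\<^sup>*" using m2[of u] m1[of v] by (meson rtrancl_trans)
    qed
  qed
  ultimately show ?thesis by blast
qed

section \<open>Edge counts of connected graphs\<close>

lemma connected_graph_edge_at:
  assumes "connected_graph V E" "u \<in> V" "v \<in> V" "u \<noteq> v"
  obtains e where "e \<in> E" "u \<in> e"
proof -
  have "(u, v) \<in> (adj E)\<^sup>*" using assms unfolding connected_graph_def by blast
  then obtain y where "{u, y} \<in> E" using assms(4) by (cases rule: converse_rtranclE) auto
  then show ?thesis using that by blast
qed

lemma two_elements:
  assumes "2 \<le> card V" "u \<in> V"
  obtains v where "v \<in> V" "v \<noteq> u"
proof -
  have "V \<noteq> {u}" using assms by auto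
  with that assms(2) show ?thesis by blast
qed

text \<open>Contraction of an edge is the induction step of the next two lemmas.\<close>

lemma connected_graph_card:
  assumes "finite V" "V \<noteq> {}" "E \<subseteq> all_edges V" "connected_graph V E"
  shows "card V \<le> card E + 1"
  using assms
proof (induction "card V" arbitrary: V E)
  case (Suc n)
  have finE: "finite E" by (rule finite_subset[OF Suc.prems(3) finite_all_edges[OF Suc.prems(1)]])
  show ?case
  proof (cases "card V = 1")
    case False
    obtain u where u: "u \<in> V" using Suc.prems by blast
    have "2 \<le> card V" using False Suc.hyps(2) by simp
    then obtain v where v: "v \<in> V" "u \<noteq> v" using two_elements u by metis
    obtain e where e: "e \<in> E" "u \<in> e"
      using connected_graph_edge_at[OF Suc.prems(4) u v] by blast
    then obtain i j where ij: "e = {i, j}" "i \<in> V" "j \<in> V" "i \<noteq> j"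
      using in_all_edgesE[OF subsetD[OF Suc.prems(3) e(1)]] by metis
    let ?G = "(`) (merge i j) ` (E - {e})"
    have "insert e (E - {e}) = E" using e by blast
    then have "connected_graph (V - {j}) ?G"
      using connected_graph_contract[of i V j "E - {e}"] ij Suc.prems by auto
    moreover have "?G \<subseteq> all_edges (V - {j})"
      using merge_edge[of i V j] ij Suc.prems(3) by auto
    moreover have "n = card (V - {j})" using Suc.hyps(2) ij by simp
    moreover have "V - {j} \<noteq> {}" using ij by blast
    ultimately have "card (V - {j}) \<le> card ?G + 1" using Suc.hyps(1) Suc.prems(1) by blast
    \<comment> \<open>Parallel edges may coincide after the merge, hence only an inequality.\<close>
    also have "\<dots> \<le> card (E - {e}) + 1" using finE by (simp add: card_image_le)
    also have "\<dots> = card E" using e finE by (metis Suc_eq_plus1 card_Suc_Diff1)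
    finally show ?thesis using Suc.prems(1) ij by (simp add: card_Diff_singleton)
  qed simp
qed simp

lemma minimal_connected_graph_card:
  assumes "finite V" "V \<noteq> {}" "E \<subseteq> all_edges V" "connected_graph V E"
    "\<And>e. e \<in> E \<Longrightarrow> \<not> connected_graph V (E - {e})"
  shows "card E + 1 = card V"
  using assms
proof (induction "card V" arbitrary: V E)
  case (Suc n)
  have finE: "finite E" by (rule finite_subset[OF Suc.prems(3) finite_all_edges[OF Suc.prems(1)]])
  show ?case
  proof (cases "card V = 1")
    case False
    obtain u where u: "u \<in> V" using Suc.prems by blast
    have "2 \<le> card V" using False Suc.hyps(2) by simp
    then obtain v where v: "v \<in> V" "u \<noteq> v" using two_elements u by metis
    obtain e where e: "e \<in> E" "u \<in> e"
      using connected_graph_edge_at[OF Suc.prems(4) u v] by blast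
    then obtain i j where ij: "e = {i, j}" "i \<in> V" "j \<in> V" "i \<noteq> j"
      using in_all_edgesE[OF subsetD[OF Suc.prems(3) e(1)]] by metis
    let ?h = "(`) (merge i j)"
    let ?G = "?h ` (E - {e})"
    have ins: "insert e (E - {e}) = E" using e by blast
    then have con: "connected_graph (V - {j}) ?G"
      using connected_graph_contract[of i V j "E - {e}"] ij Suc.prems by auto
    \<comment> \<open>Minimality passes to the contracted graph: an edge that could be spared there
      could already be spared in \<open>E\<close>.\<close>
    have nocon: "\<not> connected_graph (V - {j}) (?h ` (E - {e} - {g}))" if "g \<in> E - {e}" for g
    proof
      assume "connected_graph (V - {j}) (?h ` (E - {e} - {g}))"
      then have "connected_graph V (insert e (E - {e} - {g}))"
        using connected_graph_contract[of i V j "E - {e} - {g}"] ij Suc.prems(3) by auto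
      moreover have "insert e (E - {e} - {g}) = E - {g}" using that e by auto
      ultimately show False using Suc.prems(5) that by auto
    qed
    \<comment> \<open>Of two edges with the same image one could be dropped without changing the
      contracted graph, against minimality. So contraction loses the edge \<open>e\<close> and no
      other.\<close>
    have inj: "inj_on ?h (E - {e})"
    proof (rule inj_onI, rule ccontr)
      fix g g' assume g: "g \<in> E - {e}" "g' \<in> E - {e}" "?h g = ?h g'" "g \<noteq> g'"
      then have "?h ` (E - {e} - {g}) = ?G" by blast
      then show False using con nocon[OF g(1)] by simp
    qed
    have "?G \<subseteq> all_edges (V - {j})"
      using merge_edge[of i V j] ij Suc.prems(3) by auto
    moreover have "\<not> connected_graph (V - {j}) (?G - {f})" if fG: "f \<in> ?G" for f
    proof -
      obtain g where g: "g \<in> E - {e}" "f = ?h g" using fG by blast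
      then have "?G - {f} \<subseteq> ?h ` (E - {e} - {g})" by blast
      then show ?thesis using nocon[OF g(1)] connected_graph_mono[of _ "?G - {f}"] by metis
    qed
    moreover have "n = card (V - {j})" using Suc.hyps(2) ij by simp
    moreover have "V - {j} \<noteq> {}" using ij by blast
    ultimately have "card ?G + 1 = card (V - {j})"
      using Suc.hyps(1)[of "V - {j}" ?G] Suc.prems(1) con by blast
    moreover have "card ?G + 1 = card E"
      using inj e finE by (metis Suc_eq_plus1 card_Suc_Diff1 card_image)
    ultimately show ?thesis using Suc.prems(1) ij by simp
  next
    case True
    then obtain x where "V = {x}" by (meson card_1_singletonE)
    then have "all_edges V = {}" unfolding all_edges_def by auto
    then show ?thesis using Suc.prems True by simp
  qed
qed simp

text \<open>The edge count takes the place of acyclicity because it is easy to follow through a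
  contraction; \<open>trees_on_eq\<close> shows that the two descriptions agree.\<close>

definition trees_on :: "nat set \<Rightarrow> nat set set set" where
  "trees_on V = {E. E \<subseteq> all_edges V \<and> connected_graph V E \<and> card E + 1 = card V}"

lemma finite_trees_on: "finite V \<Longrightarrow> finite (trees_on V)"
  by (rule finite_subset[of _ "Pow (all_edges V)"]) (auto simp: trees_on_def finite_all_edges)

text \<open>A cycle would leave an edge to spare, and without it the graph would have too few edges
  to be connected. Conversely, in a connected acyclic graph every edge is a bridge, so the graph is
  minimally connected and its edge count is known.\<close>

lemma trees_on_eq:
  assumes "finite V" "V \<noteq> {}"
  shows "trees_on V = {E. E \<subseteq> all_edges V \<and> connected_graph V E \<and> acyclic_graph E}"
proof (intro set_eqI iffI; clarsimp simp: trees_on_def)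
  fix E assume E: "E \<subseteq> all_edges V" "connected_graph V E" "Suc (card E) = card V"
  show "acyclic_graph E"
    unfolding acyclic_graph_def
  proof
    assume "\<exists>xs. graph_cycle E xs"
    then obtain xs where "graph_cycle E xs" by blast
    then obtain e where e: "e \<in> E" "connected_graph V (E - {e})"
      using cycle_edge_redundant[OF E(2)] by blast
    have "finite E" by (rule finite_subset[OF E(1) finite_all_edges[OF assms(1)]])
    then have "card (E - {e}) + 1 = card E" using e by (metis Suc_eq_plus1 card_Suc_Diff1)
    moreover have "card V \<le> card (E - {e}) + 1"
      by (rule connected_graph_card[OF assms _ e(2)]) (use E(1) in blast)
    ultimately show False using E(3) by simp
  qed
next
  fix E assume E: "E \<subseteq> all_edges V" "connected_graph V E" "acyclic_graph E"
  have "card E + 1 = card V"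
  proof (rule minimal_connected_graph_card[OF assms E(1,2)])
    fix e assume "e \<in> E"
    then obtain u v where uv: "e = {u, v}" "u \<in> V" "v \<in> V" "u \<noteq> v"
      using in_all_edgesE[OF subsetD[OF E(1)]] by metis
    then have "(u, v) \<notin> (adj (E - {e}))\<^sup>*"
      using acyclic_edge_bridge[OF E(3), of u v] \<open>e \<in> E\<close> by simp
    then show "\<not> connected_graph V (E - {e})"
      using uv unfolding connected_graph_def by blast
  qed
  then show "Suc (card E) = card V" by simp
qed

text \<open>Edges that can be spared are removed until none is left. This later turns connectedness
  of the positive edges into positivity of the tree sum.\<close>

lemma connected_graph_contains_tree:
  assumes "finite V" "V \<noteq> {}" "E \<subseteq> all_edges V" "connected_graph V E"
  obtains T where "T \<in> trees_on V" "T \<subseteq> E"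
proof -
  have finE: "finite E" by (rule finite_subset[OF assms(3) finite_all_edges[OF assms(1)]])
  have "\<exists>T \<subseteq> E. T \<in> trees_on V"
    using finE assms(3,4)
  proof (induction rule: finite_psubset_induct)
    case (psubset E)
    show ?case
    proof (cases "\<exists>e\<in>E. connected_graph V (E - {e})")
      case True
      then obtain e where "e \<in> E" "connected_graph V (E - {e})" by blast
      then show ?thesis using psubset.IH[of "E - {e}"] psubset.prems by blast
    next
      case False
      then have "card E + 1 = card V"
        using minimal_connected_graph_card[OF assms(1,2)] psubset.prems by blast
      then show ?thesis using psubset.prems unfolding trees_on_def by blast
    qed
  qed
  then show ?thesis using that by blast
qed

section \<open>Tree sums\<close>

text \<open>A set \<open>S\<close> mapped bijectively onto \<open>T\<close> is a choice of one
  preimage for each element of \<open>T\<close>, so this is the distributive law. It will be applied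
  to the ways of lifting a tree of a contracted graph.\<close>

lemma sum_prod_preimages:
  fixes w :: "'a \<Rightarrow> real"
  assumes "finite E" "finite T"
  shows "(\<Sum>S | S \<subseteq> E \<and> inj_on h S \<and> h ` S = T. \<Prod>g\<in>S. w g) =
    (\<Prod>f\<in>T. \<Sum>g | g \<in> E \<and> h g = f. w g)"
  using assms(2)
proof (induction T rule: finite_induct)
  case empty
  have "{S. S \<subseteq> E \<and> inj_on h S \<and> h ` S = {}} = {{}}" by auto
  then show ?case by simp
next
  case (insert f T)
  let ?X = "\<lambda>T. {S. S \<subseteq> E \<and> inj_on h S \<and> h ` S = T}"
  let ?P = "{g. g \<in> E \<and> h g = f}"
  have fin: "finite S" if "S \<in> ?X T" for S T
    by (rule finite_subset[OF _ assms(1)]) (use that in simp)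
  \<comment> \<open>\<open>S\<close> is split into its element above \<open>f\<close>, unique by
    injectivity and hence named by \<open>THE\<close>, and the part above \<open>T\<close>.\<close>
  have "sum (prod w) (?X (insert f T)) = (\<Sum>(g, S)\<in>?P \<times> ?X T. w g * prod w S)"
  proof (rule sum.reindex_bij_witness[where i = "\<lambda>(g, S). insert g S"
        and j = "\<lambda>S. (THE g. g \<in> S \<and> h g = f, {g \<in> S. h g \<noteq> f})"])
    fix S assume S: "S \<in> ?X (insert f T)"
    then have SE: "S \<subseteq> E" and inj: "inj_on h S" and Sh: "h ` S = insert f T" by auto
    have "f \<in> h ` S" using Sh by simp
    then obtain g where g: "g \<in> S" "h g = f" by blast
    have uniq: "x = g" if "x \<in> S" "h x = f" for x
      by (rule inj_onD[OF inj]) (use g that in auto)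
    have the: "(THE g. g \<in> S \<and> h g = f) = g"
    proof (rule the_equality)
      show "g \<in> S \<and> h g = f" using g by simp
    qed (metis uniq)
    have eq: "insert g {g \<in> S. h g \<noteq> f} = S" using g(1) by (auto intro: uniq)
    have "h ` {g \<in> S. h g \<noteq> f} = h ` S - {f}" by auto
    also have "\<dots> = T" using insert.hyps(2) Sh by simp
    finally have "h ` {g \<in> S. h g \<noteq> f} = T" .
    moreover have "inj_on h {g \<in> S. h g \<noteq> f}" by (rule inj_on_subset[OF inj]) auto
    ultimately show "(THE g. g \<in> S \<and> h g = f, {g \<in> S. h g \<noteq> f}) \<in> ?P \<times> ?X T"
      using SE g the by auto
    show "(case (THE g. g \<in> S \<and> h g = f, {g \<in> S. h g \<noteq> f}) of (g, S) \<Rightarrow> insert g S) = S"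
      using the eq by simp
    have "prod w S = prod w (insert g {g \<in> S. h g \<noteq> f})" using eq by simp
    also have "\<dots> = w g * prod w {g \<in> S. h g \<noteq> f}"
      using fin[OF S] g by (subst prod.insert) auto
    finally show "(case (THE g. g \<in> S \<and> h g = f, {g \<in> S. h g \<noteq> f}) of
        (g, S) \<Rightarrow> w g * prod w S) = prod w S"
      using the by simp
  next
    fix b assume "b \<in> ?P \<times> ?X T"
    then obtain g S where b: "b = (g, S)" "g \<in> E" "h g = f" "S \<subseteq> E" "inj_on h S" "h ` S = T" by auto
    have nf: "h x \<noteq> f" if "x \<in> S" for x using b(6) that insert.hyps(2) by (metis imageI)
    show "(case b of (g, S) \<Rightarrow> insert g S) \<in> ?X (insert f T)"
    proof -
      have "h g \<notin> h ` (S - {g})" using b(3) nf by (metis DiffD1 imageE)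
      then show ?thesis using b by (simp add: inj_on_insert)
    qed
    have "(THE x. x \<in> insert g S \<and> h x = f) = g"
    proof (rule the_equality)
      show "g \<in> insert g S \<and> h g = f" using b(3) by simp
    qed (metis nf insertE)
    moreover have "{x \<in> insert g S. h x \<noteq> f} = S" using b(3) nf by auto
    ultimately show "(THE x. x \<in> (case b of (g, S) \<Rightarrow> insert g S) \<and> h x = f,
        {x \<in> (case b of (g, S) \<Rightarrow> insert g S). h x \<noteq> f}) = b"
      using b(1) by simp
  qed
  also have "\<dots> = sum w ?P * sum (prod w) (?X T)"
    by (simp add: sum_product sum.cartesian_product)
  finally show ?case using insert by simp
qed

definition tree_sum :: "nat set \<Rightarrow> (nat set \<Rightarrow> real) \<Rightarrow> real" where
  "tree_sum V W = (\<Sum>T\<in>trees_on V. \<Prod>e\<in>T. W e)"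

lemma tree_sum_cong:
  assumes "\<And>e. e \<in> all_edges V \<Longrightarrow> W e = W' e"
  shows "tree_sum V W = tree_sum V W'"
  unfolding tree_sum_def trees_on_def by (intro sum.cong prod.cong) (use assms in auto)

lemma tree_sum_singleton: "tree_sum {v} W = 1"
proof -
  have "all_edges {v} = {}" by (auto simp: all_edges_def)
  then have "trees_on {v} = {{}}" unfolding trees_on_def by (auto simp: connected_graph_def)
  then show ?thesis by (simp add: tree_sum_def)
qed

text \<open>All trees on \<open>V\<close> have the same number of edges, so the tree sum is
  homogeneous.\<close>

lemma tree_sum_scale: "tree_sum V (\<lambda>e. c * W e) = c ^ (card V - 1) * tree_sum V W"
  unfolding tree_sum_def sum_distrib_left
proof (rule sum.cong[OF refl])
  fix T assume "T \<in> trees_on V"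
  then have "card T + 1 = card V" by (simp add: trees_on_def)
  then have "card T = card V - 1" by linarith
  then show "(\<Prod>e\<in>T. c * W e) = c ^ (card V - 1) * prod W T"
    by (simp add: prod.distrib)
qed

text \<open>Every tree on two or more vertices has an edge at \<open>a\<close>, which contributes a
  zero factor.\<close>

lemma tree_sum_isolated:
  assumes "finite V" "a \<in> V" "2 \<le> card V"
    "\<And>e. e \<in> all_edges V \<Longrightarrow> a \<in> e \<Longrightarrow> W e = 0"
  shows "tree_sum V W = 0"
  unfolding tree_sum_def
proof (rule sum.neutral, rule ballI)
  fix T assume T: "T \<in> trees_on V"
  obtain b where b: "b \<in> V" "a \<noteq> b" using two_elements[OF assms(3,2)] by metis
  from T have con: "connected_graph V T" and sub: "T \<subseteq> all_edges V" by (auto simp: trees_on_def)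
  obtain e where e: "e \<in> T" "a \<in> e"
    using connected_graph_edge_at[OF con assms(2) b] by blast
  have "finite T" by (rule finite_subset[OF sub finite_all_edges[OF assms(1)]])
  moreover have "W e = 0" using assms(4) e sub by blast
  ultimately show "prod W T = 0" using e(1) by (auto simp: prod_zero_iff)
qed

text \<open>
  When \<open>j\<close> is merged into \<open>i\<close>, parallel edges from \<open>i\<close> and from \<open>j\<close> to a third vertex become one
  edge, and their weights add up.
\<close>

definition contract :: "nat \<Rightarrow> nat \<Rightarrow> (nat set \<Rightarrow> real) \<Rightarrow> nat set \<Rightarrow> real" where
  "contract i j W f = (if i \<in> f then W f + W (insert j (f - {i})) else W f)"

section \<open>Deletion and contraction\<close>

lemma sum_merge_preimages:
  assumes "finite V" "i \<in> V" "j \<in> V" "i \<noteq> j" "f \<in> all_edges (V - {j})"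
  shows "(\<Sum>g | g \<in> all_edges V - {{i, j}} \<and> merge i j ` g = f. W g) = contract i j W f"
proof -
  have f: "f \<in> all_edges V" "j \<notin> f"
    using assms(5) by (auto simp: all_edges_def)
  have fid: "merge i j ` f = f"
    using f(2) by (auto simp: merge_def image_def)
  have gf: "g = f" if "merge i j ` g = f" "j \<notin> g" for g
    using that by (auto simp: merge_def image_def)
  show ?thesis
  proof (cases "i \<in> f")
    case True
    obtain k where k: "f = {i, k}" "k \<in> V" "k \<noteq> i" "k \<noteq> j"
      by (rule in_all_edges_atE[OF assms(5) True]) simp
    have "{g. g \<in> all_edges V - {{i, j}} \<and> merge i j ` g = f} = {f, {j, k}}"
    proof (intro set_eqI iffI)
      fix g assume "g \<in> {g. g \<in> all_edges V - {{i, j}} \<and> merge i j ` g = f}"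
      then have g: "g \<in> all_edges V" "g \<noteq> {i, j}" "merge i j ` g = f" by auto
      show "g \<in> {f, {j, k}}"
      proof (cases "j \<in> g")
        case True
        obtain l where l: "g = {j, l}" "l \<noteq> j"
          by (rule in_all_edges_atE[OF g(1) True])
        then have "{i, l} = {i, k}" using g(3) k by (simp add: merge_def insert_commute)
        then show ?thesis using l by (auto simp: doubleton_eq_iff)
      qed (use gf g in blast)
    next
      fix g assume "g \<in> {f, {j, k}}"
      then consider "g = f" | "g = {j, k}" by blast
      then show "g \<in> {g. g \<in> all_edges V - {{i, j}} \<and> merge i j ` g = f}"
      proof cases
        case 1
        moreover have "f \<noteq> {i, j}" using f(2) by auto
        ultimately show ?thesis using fid f(1) by simp
      next
        case 2
        moreover have "merge i j ` {j, k} = f" using k by (simp add: merge_def insert_commute)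
        moreover have "{j, k} \<in> all_edges V" using k(2,4) assms(3) by (simp add: doubleton_in_all_edges)
        moreover have "{j, k} \<noteq> {i, j}" using k(3) by (simp add: doubleton_eq_iff)
        ultimately show ?thesis by simp
      qed
    qed
    moreover have "f \<noteq> {j, k}" using f(2) by blast
    moreover have "insert j (f - {i}) = {j, k}" using k by auto
    ultimately show ?thesis using True by (simp add: contract_def)
  next
    case False
    have "{g. g \<in> all_edges V - {{i, j}} \<and> merge i j ` g = f} = {f}"
    proof (intro set_eqI iffI)
      fix g assume "g \<in> {g. g \<in> all_edges V - {{i, j}} \<and> merge i j ` g = f}"
      then have g: "merge i j ` g = f" by auto
      then have "j \<notin> g" using False by (auto simp: merge_def image_def)
      then show "g \<in> {f}" using gf g by blast
    qed (use f fid False in auto)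
    then show ?thesis using False by (simp add: contract_def)
  qed
qed

text \<open>A tree through \<open>{i, j}\<close> amounts to a tree of the contracted graph together
  with a preimage for each of its edges. Summing over the preimages of each edge produces the
  contracted weights.\<close>

lemma sum_trees_through_edge:
  assumes "finite V" "i \<in> V" "j \<in> V" "i \<noteq> j"
  shows "(\<Sum>T | T \<in> trees_on V \<and> {i, j} \<in> T. prod W T) =
    W {i, j} * tree_sum (V - {j}) (contract i j W)"
proof -
  let ?e = "{i, j}" and ?V' = "V - {j}" and ?h = "(`) (merge i j)"
  let ?A = "all_edges V - {{i, j}}"
  let ?X = "{S. S \<subseteq> ?A \<and> connected_graph ?V' (?h ` S) \<and> card S + 1 = card ?V'}"
  have finA: "finite ?A" using finite_all_edges[OF assms(1)] by blast
  have finS: "finite S" if "S \<in> ?X" for S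
    by (rule finite_subset[OF _ finA]) (use that in simp)
  have eA: "?e \<in> all_edges V" using assms by (simp add: doubleton_in_all_edges)
  have cV: "card V = card ?V' + 1" using assms(1,3) by (metis Suc_eq_plus1 card_Suc_Diff1)
  have "(\<Sum>T | T \<in> trees_on V \<and> ?e \<in> T. prod W T) = (\<Sum>S\<in>?X. W ?e * prod W S)"
  proof (rule sum.reindex_bij_witness[where i = "insert ?e" and j = "\<lambda>T. T - {?e}"])
    fix T assume T: "T \<in> {T. T \<in> trees_on V \<and> ?e \<in> T}"
    then have T': "T \<subseteq> all_edges V" "connected_graph V T" "card T + 1 = card V" "?e \<in> T"
      by (auto simp: trees_on_def)
    have finT: "finite T" by (rule finite_subset[OF T'(1) finite_all_edges[OF assms(1)]])
    show ins: "insert ?e (T - {?e}) = T" using T' by blast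
    have "connected_graph ?V' (?h ` (T - {?e}))"
      using connected_graph_contract[of i V j "T - {?e}"] assms T' ins by auto
    moreover have "card (T - {?e}) + 1 = card T" using finT T'(4) by (metis Suc_eq_plus1 card_Suc_Diff1)
    ultimately show "T - {?e} \<in> ?X" using T' cV by auto
    show "W ?e * prod W (T - {?e}) = prod W T"
      using finT T'(4) by (simp add: prod.remove)
  next
    fix S assume S: "S \<in> ?X"
    then have nS: "?e \<notin> S" by blast
    then show "insert ?e S - {?e} = S" by blast
    have "connected_graph V (insert ?e S)"
      using connected_graph_contract[of i V j S] assms S by auto
    moreover have "card (insert ?e S) = card S + 1" using nS finS[OF S] by simp
    ultimately show "insert ?e S \<in> {T. T \<in> trees_on V \<and> ?e \<in> T}"
      using S eA cV by (auto simp: trees_on_def)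
  qed
  also have "\<dots> = W ?e * sum (prod W) ?X" by (simp add: sum_distrib_left)
  \<comment> \<open>The edge sets are grouped by their image under the merge.\<close>
  also have "sum (prod W) ?X = (\<Sum>T\<in>trees_on ?V'. sum (prod W) {S \<in> ?X. ?h ` S = T})"
  proof (rule sum.group[symmetric])
    show "finite ?X" by (rule finite_subset[of _ "Pow ?A"]) (use finA in auto)
    show "finite (trees_on ?V')" using assms(1) by (simp add: finite_trees_on)
    show "(\<lambda>S. ?h ` S) ` ?X \<subseteq> trees_on ?V'"
    proof (rule image_subsetI)
      fix S assume S: "S \<in> ?X"
      have sub: "?h ` S \<subseteq> all_edges ?V'" using S merge_edge[of i V j] assms by auto
      \<comment> \<open>Connectedness bounds the number of edges of the image from below, and
        \<open>card S\<close> bounds it from above, so the image is again a tree.\<close>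
      have "card ?V' \<le> card (?h ` S) + 1"
        by (rule connected_graph_card[OF _ _ sub]) (use assms S in auto)
      moreover have "card (?h ` S) \<le> card S" using finS[OF S] by (rule card_image_le)
      ultimately show "?h ` S \<in> trees_on ?V'" using S sub by (auto simp: trees_on_def)
    qed
  qed
  also have "\<dots> = (\<Sum>T\<in>trees_on ?V'. \<Prod>f\<in>T. contract i j W f)"
  proof (rule sum.cong[OF refl])
    fix T assume T: "T \<in> trees_on ?V'"
    then have T': "T \<subseteq> all_edges ?V'" by (simp add: trees_on_def)
    then have finT: "finite T" by (rule finite_subset) (use assms(1) finite_all_edges in simp)
    \<comment> \<open>Among the sets mapped onto \<open>T\<close>, having as many edges as
      \<open>T\<close> is the same as injectivity of the merge.\<close>
    have "{S \<in> ?X. ?h ` S = T} = {S. S \<subseteq> ?A \<and> inj_on ?h S \<and> ?h ` S = T}"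
    proof (intro set_eqI iffI)
      fix S assume "S \<in> {S \<in> ?X. ?h ` S = T}"
      then have S: "S \<in> ?X" "?h ` S = T" by auto
      have "card (?h ` S) = card S" using S T by (simp add: trees_on_def)
      then have "inj_on ?h S" using finS[OF S(1)] by (rule eq_card_imp_inj_on[rotated])
      then show "S \<in> {S. S \<subseteq> ?A \<and> inj_on ?h S \<and> ?h ` S = T}" using S by blast
    next
      fix S assume "S \<in> {S. S \<subseteq> ?A \<and> inj_on ?h S \<and> ?h ` S = T}"
      then have S: "S \<subseteq> ?A" "inj_on ?h S" "?h ` S = T" by auto
      have "card S = card T" using card_image[OF S(2)] S(3) by simp
      then show "S \<in> {S \<in> ?X. ?h ` S = T}" using S T by (auto simp: trees_on_def)
    qed
    then have "sum (prod W) {S \<in> ?X. ?h ` S = T} = (\<Prod>f\<in>T. \<Sum>g | g \<in> ?A \<and> ?h g = f. W g)"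
      using sum_prod_preimages[OF finA finT, where h = ?h and w = W] by simp
    also have "\<dots> = (\<Prod>f\<in>T. contract i j W f)"
      by (intro prod.cong refl sum_merge_preimages) (use assms T' in auto)
    finally show "sum (prod W) {S \<in> ?X. ?h ` S = T} = (\<Prod>f\<in>T. contract i j W f)" .
  qed
  finally show ?thesis by (simp add: tree_sum_def)
qed

text \<open>The tree sum is affine in the weight of a single edge, with the tree sum of the
  contraction as slope. Two arbitrary values of that weight are compared, instead of deleting the
  edge, because the identity is also applied to mesh weights, which do not vanish when the original
  weight is cleared.\<close>

lemma tree_sum_deletion_contraction:
  assumes "finite V" "i \<in> V" "j \<in> V" "i \<noteq> j"
    and same: "\<And>f. f \<in> all_edges V \<Longrightarrow> f \<noteq> {i, j} \<Longrightarrow> W' f = W f"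
  shows "tree_sum V W = tree_sum V W' +
    (W {i, j} - W' {i, j}) * tree_sum (V - {j}) (contract i j W)"
proof -
  let ?e = "{i, j}"
  let ?P = "{T. T \<in> trees_on V \<and> ?e \<in> T}"
  have fin: "finite (trees_on V)" using assms(1) by (rule finite_trees_on)
  have split: "tree_sum V U = sum (prod U) ?P + (\<Sum>T | T \<in> trees_on V \<and> ?e \<notin> T. prod U T)" for U
    unfolding tree_sum_def using fin
    by (subst sum.union_disjoint[symmetric]) (auto intro!: sum.cong)
  have rest: "(\<Sum>T | T \<in> trees_on V \<and> ?e \<notin> T. prod W T) = (\<Sum>T | T \<in> trees_on V \<and> ?e \<notin> T. prod W' T)"
  proof (intro sum.cong prod.cong refl)
    fix T f assume "T \<in> {T. T \<in> trees_on V \<and> ?e \<notin> T}" "f \<in> T"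
    then have "f \<in> all_edges V" "f \<noteq> ?e" by (auto simp: trees_on_def)
    then show "W f = W' f" using same by simp
  qed
  \<comment> \<open>The contracted weights read only edges other than \<open>{i, j}\<close>, so
    \<open>W\<close> and \<open>W'\<close> have the same slope.\<close>
  have cc: "contract i j W f = contract i j W' f" if f: "f \<in> all_edges (V - {j})" for f
  proof -
    have f1: "f \<in> all_edges V" "j \<notin> f" using f by (auto simp: all_edges_def)
    then have "f \<noteq> ?e" by blast
    then have 1: "W' f = W f" using same f1 by blast
    have "W' (insert j (f - {i})) = W (insert j (f - {i}))" if fi: "i \<in> f"
    proof -
      obtain k where k: "f = {i, k}" "k \<in> V" "k \<noteq> i" "k \<noteq> j"
        by (rule in_all_edges_atE[OF f fi]) simp
      then have "insert j (f - {i}) = {j, k}" by auto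
      moreover have "{j, k} \<in> all_edges V" "{j, k} \<noteq> ?e"
        using k assms by (auto simp: doubleton_in_all_edges doubleton_eq_iff)
      ultimately show ?thesis using same by simp
    qed
    with 1 show ?thesis by (simp add: contract_def)
  qed
  have "tree_sum (V - {j}) (contract i j W) = tree_sum (V - {j}) (contract i j W')"
    by (rule tree_sum_cong) (use cc in blast)
  then show ?thesis
    using split[of W] split[of W'] rest
      sum_trees_through_edge[OF assms(1-4), of W] sum_trees_through_edge[OF assms(1-4), of W']
    by (simp add: algebra_simps)
qed

section \<open>The star-mesh identity\<close>

text \<open>Only the full star can contribute. The induction treats one spoke \<open>{n, a}\<close>:
  deleting it isolates \<open>a\<close>, and contracting it leaves the star without
  \<open>a\<close>.\<close>

lemma tree_sum_star:
  assumes "finite V" "n \<in> V" "\<And>e. e \<in> all_edges V \<Longrightarrow> n \<notin> e \<Longrightarrow> W e = 0"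
  shows "tree_sum V W = (\<Prod>a\<in>V - {n}. W {a, n})"
  using assms
proof (induction "card V" arbitrary: V W)
  case 0
  then show ?case by auto
next
  case (Suc N)
  show ?case
  proof (cases "V = {n}")
    case True
    then show ?thesis by (simp add: tree_sum_singleton)
  next
    case False
    then obtain a where a: "a \<in> V" "n \<noteq> a" using Suc.prems(2) by blast
    let ?W' = "W({n, a} := 0)" and ?C = "contract n a W"
    have "card {n, a} \<le> card V" by (rule card_mono) (use Suc.prems a in auto)
    then have two: "2 \<le> card V" using a by simp
    have "tree_sum V ?W' = 0"
    proof (rule tree_sum_isolated[OF Suc.prems(1) a(1) two])
      fix e assume e: "e \<in> all_edges V" "a \<in> e"
      obtain b where b: "e = {a, b}" "b \<noteq> a" by (rule in_all_edges_atE[OF e])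
      show "?W' e = 0"
      proof (cases "b = n")
        case True
        then show ?thesis using b by (simp add: insert_commute)
      next
        case False
        then have "n \<notin> e" using a b by simp
        then show ?thesis using Suc.prems(3)[OF e(1)] by simp
      qed
    qed
    then have 1: "tree_sum V W = W {n, a} * tree_sum (V - {a}) ?C"
      using tree_sum_deletion_contraction[of V n a ?W' W] Suc.prems a by simp
    have "tree_sum (V - {a}) ?C = (\<Prod>b\<in>V - {a} - {n}. ?C {b, n})"
    proof (rule Suc.hyps(1))
      show "N = card (V - {a})" using Suc.hyps(2) a by simp
      fix e assume e: "e \<in> all_edges (V - {a})" "n \<notin> e"
      then have "e \<in> all_edges V" by (auto simp: all_edges_def)
      then show "?C e = 0" using Suc.prems(3) e(2) by (simp add: contract_def)
    qed (use Suc.prems a in auto)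
    also have "\<dots> = (\<Prod>b\<in>V - {n} - {a}. W {b, n})"
    proof (rule prod.cong)
      fix b assume b: "b \<in> V - {n} - {a}"
      then have "{b, n} - {n} = {b}" by auto
      moreover have "W {a, b} = 0"
        by (rule Suc.prems(3)) (use a b in \<open>auto simp: doubleton_in_all_edges\<close>)
      ultimately show "?C {b, n} = W {b, n}" by (simp add: contract_def)
    qed auto
    finally have "tree_sum V W = W {a, n} * (\<Prod>b\<in>V - {n} - {a}. W {b, n})"
      using 1 by (simp add: insert_commute)
    also have "\<dots> = (\<Prod>b\<in>V - {n}. W {b, n})"
      using Suc.prems(1) a by (subst (2) prod.remove[of _ a]) auto
    finally show ?thesis .
  qed
qed

text \<open>The star-mesh transform, with \<open>s\<close> meant to be the total weight of the edges at \<open>n\<close>.\<close>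

definition mesh :: "nat \<Rightarrow> real \<Rightarrow> (nat set \<Rightarrow> real) \<Rightarrow> nat set \<Rightarrow> real" where
  "mesh n s W f = W f + (\<Prod>a\<in>f. W {a, n}) / s"

lemma mesh_doubleton: "a \<noteq> b \<Longrightarrow> mesh n s W {a, b} = W {a, b} + W {a, n} * W {b, n} / s"
  by (simp add: mesh_def)

text \<open>Eliminating \<open>n\<close> commutes with contracting an edge away from
  \<open>n\<close>, since \<open>(W {i, n} + W {j, n}) * W {k, n}\<close> distributes.\<close>

lemma contract_mesh:
  assumes "i \<noteq> j" "n \<noteq> i" "n \<noteq> j" "f \<in> all_edges (V - {n} - {j})"
  shows "contract i j (mesh n s W) f = mesh n s (contract i j W) f"
proof (cases "i \<in> f")
  case True
  obtain k where k: "f = {i, k}" "k \<in> V - {n} - {j}" "k \<noteq> i"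
    by (rule in_all_edges_atE[OF assms(4) True])
  have "insert j (f - {i}) = {j, k}" "{i, n} - {i} = {n}" "j \<noteq> k" "i \<notin> {k, n}"
    using k assms by auto
  then show ?thesis using k assms by (simp add: contract_def mesh_doubleton distrib_right add_divide_distrib)
next
  case False
  obtain a b where ab: "f = {a, b}" "a \<noteq> b" by (rule in_all_edgesE[OF assms(4)])
  then have "contract i j W {a, n} = W {a, n}" "contract i j W {b, n} = W {b, n}"
    using False assms by (auto simp: contract_def)
  then show ?thesis using False ab by (simp add: contract_def mesh_doubleton)
qed

text \<open>The weight of \<open>{j, n}\<close> moves to \<open>{i, n}\<close>, so the same
  \<open>s\<close> serves before and after the contraction.\<close>

lemma sum_contract_star:
  assumes "finite V" "i \<in> V" "j \<in> V" "i \<noteq> j" "n \<noteq> i" "n \<noteq> j"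
  shows "(\<Sum>a\<in>V - {j} - {n}. contract i j W {a, n}) = (\<Sum>a\<in>V - {n}. W {a, n})"
proof -
  have "(\<Sum>a\<in>V - {j} - {n}. contract i j W {a, n}) =
      (\<Sum>a\<in>V - {j} - {n}. W {a, n} + (if a = i then W {j, n} else 0))"
  proof (rule sum.cong[OF refl])
    fix a assume "a \<in> V - {j} - {n}"
    moreover have "{i, n} - {i} = {n}" using assms by auto
    ultimately show "contract i j W {a, n} = W {a, n} + (if a = i then W {j, n} else 0)"
      using assms by (auto simp: contract_def)
  qed
  also have "\<dots> = (\<Sum>a\<in>V - {n} - {j}. W {a, n}) + W {j, n}"
  proof -
    have "V - {j} - {n} = V - {n} - {j}" by blast
    then show ?thesis using assms by (simp add: sum.distrib sum.delta)
  qed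
  also have "\<dots> = (\<Sum>a\<in>V - {n}. W {a, n})"
    using assms by (subst (2) sum.remove[of _ j]) auto
  finally show ?thesis .
qed

section \<open>Joint induction for the star-mesh identity and Cayley's formula\<close>

definition star_mesh_identity :: "nat set \<Rightarrow> bool" where
  "star_mesh_identity V \<longleftrightarrow> (\<forall>n W. n \<in> V \<longrightarrow> (\<forall>e\<in>all_edges V. 0 \<le> W e) \<longrightarrow>
     0 < (\<Sum>a\<in>V - {n}. W {a, n}) \<longrightarrow>
     tree_sum V W = (\<Sum>a\<in>V - {n}. W {a, n}) *
       tree_sum (V - {n}) (mesh n (\<Sum>a\<in>V - {n}. W {a, n}) W))"

text \<open>
  Cayley's formula \<open>(\<Prod>x) X ^ (card V - 2)\<close> with \<open>X\<close> the sum of \<open>x\<close>, multiplied by \<open>X\<^sup>2\<close> so as to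
  avoid the exponent \<open>-1\<close>.
\<close>

definition cayley_formula :: "nat set \<Rightarrow> bool" where
  "cayley_formula V \<longleftrightarrow> (\<forall>x. (\<forall>a\<in>V. 0 < x a) \<longrightarrow>
     tree_sum V (\<lambda>e. \<Prod>a\<in>e. x a) * (\<Sum>a\<in>V. x a)\<^sup>2 = (\<Prod>a\<in>V. x a) * (\<Sum>a\<in>V. x a) ^ card V)"

text \<open>The left side is the product of the spokes \<open>W {a, n}\<close>. The mesh has weights
  \<open>W {a, n} * W {b, n} / s\<close>, so homogeneity and Cayley's formula on
  \<open>V - {n}\<close> evaluate the right side to the same product.\<close>

lemma star_mesh_empty_rest:
  assumes V: "finite V" "n \<in> V"
    and cayley: "cayley_formula (V - {n})"
    and nonneg: "\<And>e. e \<in> all_edges V \<Longrightarrow> 0 \<le> W e"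
    and s: "s = (\<Sum>a\<in>V - {n}. W {a, n})" "0 < s"
    and zero: "\<And>e. e \<in> all_edges (V - {n}) \<Longrightarrow> W e = 0"
  shows "tree_sum V W = s * tree_sum (V - {n}) (mesh n s W)"
proof -
  let ?V' = "V - {n}" and ?x = "\<lambda>a. W {a, n}"
  let ?m = "card ?V'"
  have star: "tree_sum V W = prod ?x ?V'"
  proof (rule tree_sum_star[OF V])
    fix e assume "e \<in> all_edges V" "n \<notin> e"
    then have "e \<in> all_edges ?V'" by (auto simp: all_edges_def)
    then show "W e = 0" by (rule zero)
  qed
  have mesh: "mesh n s W e = 1 / s * (\<Prod>a\<in>e. ?x a)" if "e \<in> all_edges ?V'" for e
    using zero[OF that] by (simp add: mesh_def)
  have xnn: "0 \<le> ?x a" if "a \<in> ?V'" for a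
    by (rule nonneg) (use that V in \<open>simp add: doubleton_in_all_edges\<close>)
  have ne: "?V' \<noteq> {}"
  proof
    assume "?V' = {}"
    then show False using s by (simp only: sum.empty less_irrefl)
  qed
  then have m: "1 \<le> ?m" using V(1) by (simp add: Suc_leI card_gt_0_iff)
  show ?thesis
  proof (cases "\<forall>a\<in>?V'. 0 < ?x a")
    case True
    let ?T = "tree_sum ?V' (\<lambda>e. \<Prod>a\<in>e. ?x a)"
    have T: "?T * s\<^sup>2 = prod ?x ?V' * s ^ ?m"
      using cayley[unfolded cayley_formula_def, rule_format, of ?x] True unfolding s(1) by simp
    have "tree_sum ?V' (mesh n s W) = (1 / s) ^ (?m - 1) * ?T"
      unfolding tree_sum_scale[symmetric] by (rule tree_sum_cong) (rule mesh)
    then have "s * tree_sum ?V' (mesh n s W) = (1 / s) ^ (?m - 1) * (?T * s)"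
      by (simp only: mult_ac)
    \<comment> \<open>One factor \<open>s\<close> of Cayley's formula cancels, and the remaining
      power is the one that homogeneity takes out.\<close>
    also have "?T * s = prod ?x ?V' * s ^ (?m - 1)"
    proof -
      have "s ^ ?m = s ^ (?m - 1) * s" using m by (cases ?m) auto
      then show ?thesis using T s(2) by (simp add: power2_eq_square)
    qed
    finally show ?thesis using star s(2) by (simp add: power_one_over)
  next
    \<comment> \<open>Cayley's formula was stated for positive values. If a spoke vanishes, both
      sides are zero, because its end is isolated in the mesh.\<close>
    case False
    then obtain a where a: "a \<in> ?V'" "?x a = 0" using xnn by (metis order_le_less)
    then have "prod ?x ?V' = 0" using V by auto
    moreover have "tree_sum ?V' (mesh n s W) = 0"
    proof (rule tree_sum_isolated[of _ a])
      \<comment> \<open>If \<open>a\<close> were the only other vertex, its zero spoke would be all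
        of \<open>s\<close>.\<close>
      have "?m \<noteq> 1"
      proof
        assume "?m = 1"
        then have "?V' = {a}" using a(1) by (metis card_1_singletonE singletonD)
        then have "s = ?x a" using s(1) by simp
        then show False using s(2) a(2) by simp
      qed
      then show "2 \<le> ?m" using m by linarith
      fix e assume e: "e \<in> all_edges ?V'" "a \<in> e"
      obtain b where "e = {a, b}" "b \<noteq> a" by (rule in_all_edges_atE[OF e])
      then show "mesh n s W e = 0" using a mesh[OF e(1)] by simp
    qed (use V a in auto)
    ultimately show ?thesis using star by simp
  qed
qed

text \<open>Induction on the number of nonzero weights away from \<open>n\<close>. Both sides are
  affine in such a weight \<open>W e\<close>: at zero they agree by induction, and the slopes agree
  by the identity for the contracted graph, which has one vertex less.\<close>

lemma star_mesh_step:
  assumes V: "finite V" "n \<in> V"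
    and cayley: "cayley_formula (V - {n})"
    and smaller: "\<And>j. j \<in> V \<Longrightarrow> j \<noteq> n \<Longrightarrow> star_mesh_identity (V - {j})"
    and nonneg: "\<And>e. e \<in> all_edges V \<Longrightarrow> 0 \<le> W e"
    and s: "s = (\<Sum>a\<in>V - {n}. W {a, n})" "0 < s"
  shows "tree_sum V W = s * tree_sum (V - {n}) (mesh n s W)"
  using nonneg s
proof (induction "card {e \<in> all_edges (V - {n}). W e \<noteq> 0}" arbitrary: W)
  case 0
  have fin: "finite {e \<in> all_edges (V - {n}). W e \<noteq> 0}" using V finite_all_edges by simp
  show ?case
  proof (rule star_mesh_empty_rest[OF V cayley])
    show "W e = 0" if "e \<in> all_edges (V - {n})" for e
      using 0(1) fin that by auto
  qed (use 0 in auto)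
next
  case (Suc c)
  let ?V' = "V - {n}"
  have fin: "finite {e \<in> all_edges ?V'. W e \<noteq> 0}" using V finite_all_edges by simp
  have "{e \<in> all_edges ?V'. W e \<noteq> 0} \<noteq> {}" using Suc.hyps(2) by force
  then obtain e where e: "e \<in> all_edges ?V'" "W e \<noteq> 0" by blast
  obtain i j where ij: "e = {i, j}" "i \<in> ?V'" "j \<in> ?V'" "i \<noteq> j" by (rule in_all_edgesE[OF e(1)])
  define W0 where "W0 = W(e := 0)"
  \<comment> \<open>The spokes at \<open>n\<close> keep their weights, so clearing \<open>e\<close>
    leaves \<open>s\<close> unchanged.\<close>
  have W0_star: "W0 {a, n} = W {a, n}" for a
  proof -
    have "{a, n} \<noteq> e" using ij by auto
    then show ?thesis by (simp add: W0_def)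
  qed
  have "{e \<in> all_edges ?V'. W0 e \<noteq> 0} = {e \<in> all_edges ?V'. W e \<noteq> 0} - {e}"
    by (auto simp: W0_def)
  then have "c = card {e \<in> all_edges ?V'. W0 e \<noteq> 0}"
    using Suc.hyps(2) fin e by (simp add: card_Diff_singleton)
  then have del: "tree_sum V W0 = s * tree_sum ?V' (mesh n s W0)"
    by (rule Suc.hyps(1)) (use Suc.prems W0_star in \<open>auto simp: W0_def\<close>)
  have con: "tree_sum (V - {j}) (contract i j W) =
      s * tree_sum (V - {j} - {n}) (mesh n s (contract i j W))"
  proof -
    have sum: "(\<Sum>a\<in>V - {j} - {n}. contract i j W {a, n}) = s"
      using sum_contract_star[of V i j n W] V ij Suc.prems(2) by auto
    have nn: "\<forall>f\<in>all_edges (V - {j}). 0 \<le> contract i j W f"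
    proof
      fix f assume f: "f \<in> all_edges (V - {j})"
      have fV: "f \<in> all_edges V" using f by (auto simp: all_edges_def)
      show "0 \<le> contract i j W f"
      proof (cases "i \<in> f")
        case True
        obtain k where k: "f = {i, k}" "k \<in> V - {j}" "k \<noteq> i"
          by (rule in_all_edges_atE[OF f True])
        then have "insert j (f - {i}) = {j, k}" by auto
        moreover have "{j, k} \<in> all_edges V" using k ij by (simp add: doubleton_in_all_edges)
        ultimately show ?thesis using True Suc.prems(1) fV by (simp add: contract_def)
      qed (use Suc.prems(1) fV in \<open>simp add: contract_def\<close>)
    qed
    have "n \<in> V - {j}" using V ij by auto
    then show ?thesis
      using smaller[of j, unfolded star_mesh_identity_def, rule_format, of n "contract i j W"] nn sum ij Suc.prems(3)
      by auto
  qed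
  have "tree_sum V W = tree_sum V W0 + W e * tree_sum (V - {j}) (contract i j W)"
    using tree_sum_deletion_contraction[of V i j W0 W] V ij by (simp add: W0_def)
  moreover have "tree_sum ?V' (mesh n s W) = tree_sum ?V' (mesh n s W0) +
      W e * tree_sum (?V' - {j}) (contract i j (mesh n s W))"
  proof -
    \<comment> \<open>The term that the mesh adds depends on the spokes only and cancels in the
      difference.\<close>
    have diff: "mesh n s W f - mesh n s W0 f = W f - W0 f" for f
      by (simp add: mesh_def W0_star)
    have "mesh n s W0 f = mesh n s W f" if "f \<noteq> {i, j}" for f
      using diff[of f] that ij(1) by (simp add: W0_def)
    moreover have "mesh n s W {i, j} - mesh n s W0 {i, j} = W e"
      unfolding diff by (simp add: W0_def ij(1))
    ultimately show ?thesis
      using tree_sum_deletion_contraction[of ?V' i j "mesh n s W0" "mesh n s W"] V ij by simp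
  qed
  moreover have "tree_sum (?V' - {j}) (contract i j (mesh n s W)) =
      tree_sum (V - {j} - {n}) (mesh n s (contract i j W))"
  proof -
    have "?V' - {j} = V - {j} - {n}" by blast
    moreover have "tree_sum (?V' - {j}) (contract i j (mesh n s W)) =
        tree_sum (?V' - {j}) (mesh n s (contract i j W))"
      by (rule tree_sum_cong, rule contract_mesh) (use ij in auto)
    ultimately show ?thesis by simp
  qed
  ultimately show ?case using del con by (simp add: algebra_simps)
qed

text \<open>With edge weights \<open>x a * x b\<close> the star sum at \<open>n\<close> is
  \<open>x n * Y\<close>, and the mesh multiplies the weight of each remaining edge by
  \<open>1 + x n / Y = X / Y\<close>. Homogeneity and the formula on \<open>V - {n}\<close> then
  give the claim.\<close>

lemma cayley_step:
  assumes V: "finite V" "n \<in> V" "V \<noteq> {n}"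
    and star_mesh: "star_mesh_identity V"
    and cayley: "cayley_formula (V - {n})"
  shows "cayley_formula V"
  unfolding cayley_formula_def
proof (intro allI impI)
  fix x :: "nat \<Rightarrow> real" assume x: "\<forall>a\<in>V. 0 < x a"
  let ?V' = "V - {n}" and ?W = "\<lambda>e. \<Prod>a\<in>e. x a"
  define m where "m = card ?V' - 1"
  define Y where "Y = (\<Sum>a\<in>?V'. x a)"
  define X where "X = x n + Y"
  define s where "s = (\<Sum>a\<in>?V'. ?W {a, n})"
  have ne: "?V' \<noteq> {}" using V by auto
  have card': "card ?V' = Suc m" using ne V(1) by (simp add: m_def card_gt_0_iff)
  have cardV: "card V = Suc (Suc m)" using card' V by (metis card_Suc_Diff1)
  have Y: "0 < Y" unfolding Y_def by (rule sum_pos) (use V x ne in auto)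
  have xn: "0 < x n" using x V by blast
  have X: "(\<Sum>a\<in>V. x a) = X" unfolding X_def Y_def using V by (simp add: sum.remove)
  have s: "s = x n * Y"
    unfolding s_def Y_def sum_distrib_left by (rule sum.cong) (auto simp: mult.commute)
  have "tree_sum V ?W = s * tree_sum ?V' (mesh n s ?W)"
    unfolding s_def
  proof (rule star_mesh[unfolded star_mesh_identity_def, rule_format])
    show "0 \<le> ?W e" if "e \<in> all_edges V" for e
      using that all_edges_subset_Pow x by (intro prod_nonneg) (force intro: less_imp_le)
    show "0 < (\<Sum>a\<in>?V'. ?W {a, n})" using s s_def Y xn by simp
  qed (use V in auto)
  also have "tree_sum ?V' (mesh n s ?W) = tree_sum ?V' (\<lambda>e. X / Y * ?W e)"
  proof (rule tree_sum_cong)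
    fix e assume e: "e \<in> all_edges ?V'"
    obtain a b where "e = {a, b}" "a \<in> ?V'" "b \<in> ?V'" "a \<noteq> b" by (rule in_all_edgesE[OF e])
    then show "mesh n s ?W e = X / Y * ?W e"
      using Y xn by (simp add: mesh_doubleton s X_def field_simps)
  qed
  also have "\<dots> = (X / Y) ^ m * tree_sum ?V' ?W"
    unfolding tree_sum_scale card' by simp
  finally have T: "tree_sum V ?W = x n * Y * ((X / Y) ^ m * tree_sum ?V' ?W)" using s by simp
  have "tree_sum ?V' ?W * Y\<^sup>2 = prod x ?V' * Y ^ Suc m"
    using cayley x unfolding cayley_formula_def Y_def card' by blast
  then have "tree_sum ?V' ?W * Y = prod x ?V' * Y ^ m"
    using Y by (simp add: power2_eq_square)
  moreover have "tree_sum V ?W = x n * (X / Y) ^ m * (tree_sum ?V' ?W * Y)"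
    using T by simp
  ultimately have "tree_sum V ?W = x n * prod x ?V' * X ^ m"
    using Y by (simp add: power_divide)
  moreover have "prod x V = x n * prod x ?V'" using V by (simp add: prod.remove)
  ultimately show "tree_sum V ?W * (\<Sum>a\<in>V. x a)\<^sup>2 = prod x V * (\<Sum>a\<in>V. x a) ^ card V"
    by (simp add: X cardV power2_eq_square)
qed

text \<open>For \<open>V\<close>, the star-mesh identity comes first, from both statements on one
  vertex less; it then yields Cayley's formula for \<open>V\<close>. On a single vertex the star sum
  is empty, so the positivity hypothesis of the identity fails.\<close>

lemma star_mesh_identity_and_cayley_formula:
  "finite V \<Longrightarrow> V \<noteq> {} \<Longrightarrow> star_mesh_identity V \<and> cayley_formula V"
proof (induction "card V" arbitrary: V)
  case (Suc N)
  show ?case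
  proof (cases "\<exists>v. V = {v}")
    case True
    then obtain v where "V = {v}" by blast
    then show ?thesis
      by (simp add: star_mesh_identity_def cayley_formula_def tree_sum_singleton power2_eq_square)
  next
    case False
    have IH: "star_mesh_identity (V - {j}) \<and> cayley_formula (V - {j})" if "j \<in> V" for j
    proof (rule Suc.hyps(1))
      show "N = card (V - {j})" using Suc.hyps(2) that by simp
      show "V - {j} \<noteq> {}" using False that by blast
    qed (use Suc.prems in simp)
    have sm: "star_mesh_identity V"
      unfolding star_mesh_identity_def
      by (intro allI impI star_mesh_step) (use Suc.prems IH in auto)
    obtain n where "n \<in> V" using Suc.prems by blast
    then show ?thesis using cayley_step[of V n] sm IH[of n] False Suc.prems by blast
  qed
qed simp

lemma star_mesh:
  assumes "finite V" "n \<in> V" "\<And>e. e \<in> all_edges V \<Longrightarrow> 0 \<le> W e"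
    and "s = (\<Sum>a\<in>V - {n}. W {a, n})" "0 < s"
  shows "tree_sum V W = s * tree_sum (V - {n}) (mesh n s W)"
  using star_mesh_identity_and_cayley_formula[of V] assms
  unfolding star_mesh_identity_def by blast

section \<open>Derivatives along the elimination\<close>

lemma finite_vertices: "finite (vertices k)"
  by (simp add: vertices_def)

lemma card_vertices: "card (vertices k) = k"
  by (simp add: vertices_def)

lemma vertices_Suc_minus: "vertices (Suc m) - {Suc m} = vertices m"
  by (auto simp: vertices_def)

lemma vertices_Suc: "vertices (Suc m) = insert (Suc m) (vertices m)"
  by (auto simp: vertices_def)

lemma spanning_trees_eq: "1 \<le> p \<Longrightarrow> spanning_trees p = trees_on (vertices p)"
  unfolding spanning_trees_def by (rule trees_on_eq[symmetric]) (auto simp: vertices_def)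

definition sym_nonneg_on :: "nat \<Rightarrow> (nat \<Rightarrow> nat \<Rightarrow> real) \<Rightarrow> bool" where
  "sym_nonneg_on k w \<longleftrightarrow> (\<forall>a\<in>vertices k. \<forall>b\<in>vertices k. w a b = w b a \<and> 0 \<le> w a b)"

lemma sym_nonneg_onD:
  assumes "sym_nonneg_on k w" "a \<in> vertices k" "b \<in> vertices k"
  shows "w a b = w b a" "0 \<le> w a b"
  using assms unfolding sym_nonneg_on_def by blast+

lemma edge_weight_sym:
  assumes "sym_nonneg_on k w" "a \<in> vertices k" "b \<in> vertices k"
  shows "edge_weight w {a, b} = w a b"
  using sym_nonneg_onD(1)[OF assms]
  by (cases a b rule: linorder_cases) (simp_all add: edge_weight_def min_def max_def)

lemma edge_weight_nonneg:
  assumes "sym_nonneg_on k w" "e \<in> all_edges (vertices k)"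
  shows "0 \<le> edge_weight w e"
proof -
  obtain a b where "e = {a, b}" "a \<in> vertices k" "b \<in> vertices k"
    by (rule in_all_edgesE[OF assms(2)])
  then show ?thesis using edge_weight_sym[OF assms(1)] sym_nonneg_onD(2)[OF assms(1)] by simp
qed

text \<open>A vanishing star sum of nonnegative weights would isolate the last vertex and make the
  tree sum zero. So positivity of the tree sum keeps every division and logarithm of the elimination
  legitimate.\<close>

lemma star_sum_pos:
  assumes w: "sym_nonneg_on (Suc m) w" and m: "1 \<le> m"
    and pos: "0 < tree_sum (vertices (Suc m)) (edge_weight w)"
  shows "0 < (\<Sum>j\<in>vertices m. w (Suc m) j)"
proof (rule ccontr)
  let ?n = "Suc m"
  have n: "?n \<in> vertices ?n" by (simp add: vertices_def)
  have nn: "0 \<le> w ?n j" if "j \<in> vertices m" for j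
    by (rule sym_nonneg_onD(2)[OF w n]) (use that in \<open>simp add: vertices_Suc\<close>)
  assume "\<not> 0 < (\<Sum>j\<in>vertices m. w ?n j)"
  moreover have "0 \<le> (\<Sum>j\<in>vertices m. w ?n j)" by (rule sum_nonneg) (rule nn)
  ultimately have "(\<Sum>j\<in>vertices m. w ?n j) = 0" by linarith
  then have zero: "w ?n j = 0" if "j \<in> vertices m" for j
    using nn that sum_nonneg_eq_0_iff[OF finite_vertices[of m], of "w ?n"] by blast
  have "tree_sum (vertices ?n) (edge_weight w) = 0"
  proof (rule tree_sum_isolated[OF finite_vertices n])
    show "2 \<le> card (vertices ?n)" using m by (simp add: card_vertices)
    fix e assume e: "e \<in> all_edges (vertices ?n)" "?n \<in> e"
    obtain b where b: "e = {?n, b}" "b \<in> vertices ?n" "b \<noteq> ?n" by (rule in_all_edges_atE[OF e])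
    then have "b \<in> vertices m" by (simp add: vertices_Suc)
    then show "edge_weight w e = 0" using b edge_weight_sym[OF w n] zero by simp
  qed
  with pos show False by simp
qed

lemma sym_nonneg_on_mesh:
  assumes "sym_nonneg_on (Suc m) w" "0 < s"
  shows "sym_nonneg_on m (\<lambda>a b. w a b + w a (Suc m) * w (Suc m) b / s)"
  unfolding sym_nonneg_on_def
proof (intro ballI conjI)
  fix a b assume "a \<in> vertices m" "b \<in> vertices m"
  then have ab: "a \<in> vertices (Suc m)" "b \<in> vertices (Suc m)" by (auto simp: vertices_Suc)
  have n: "Suc m \<in> vertices (Suc m)" by (simp add: vertices_def)
  note w = sym_nonneg_onD[OF assms(1)]
  show "w a b + w a (Suc m) * w (Suc m) b / s = w b a + w b (Suc m) * w (Suc m) a / s"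
    using w(1)[OF ab] w(1)[OF ab(1) n] w(1)[OF ab(2) n] by simp
  show "0 \<le> w a b + w a (Suc m) * w (Suc m) b / s"
    using w(2)[OF ab] w(2)[OF ab(1) n] w(2)[OF n ab(2)] assms(2) by simp
qed

text \<open>The identity in the form in which the program applies it, to whole matrices. The update
  also writes to the diagonal, which no edge reads.\<close>

lemma star_mesh_matrix:
  assumes w: "sym_nonneg_on (Suc m) w"
    and s: "s = (\<Sum>j\<in>vertices m. w (Suc m) j)" "0 < s"
  shows "tree_sum (vertices (Suc m)) (edge_weight w) =
    s * tree_sum (vertices m) (edge_weight (\<lambda>a b. w a b + w a (Suc m) * w (Suc m) b / s))"
    (is "_ = _ * tree_sum _ (edge_weight ?w')")
proof -
  let ?n = "Suc m"
  have n: "?n \<in> vertices ?n" by (simp add: vertices_def)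
  have sub: "a \<in> vertices ?n" if "a \<in> vertices m" for a using that by (simp add: vertices_Suc)
  note sw = sym_nonneg_onD[OF w]
  have star: "edge_weight w {a, ?n} = w ?n a" if "a \<in> vertices m" for a
    using edge_weight_sym[OF w sub[OF that] n] sw(1)[OF sub[OF that] n] by simp
  have sum: "s = (\<Sum>a\<in>vertices ?n - {?n}. edge_weight w {a, ?n})"
    unfolding s(1) vertices_Suc_minus by (rule sum.cong) (simp_all add: star)
  have "tree_sum (vertices ?n) (edge_weight w) =
      s * tree_sum (vertices m) (mesh ?n s (edge_weight w))"
    using star_mesh[OF finite_vertices n _ sum s(2)] edge_weight_nonneg[OF w]
    by (simp add: vertices_Suc_minus)
  also have "tree_sum (vertices m) (mesh ?n s (edge_weight w)) = tree_sum (vertices m) (edge_weight ?w')"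
  proof (rule tree_sum_cong)
    fix e assume e: "e \<in> all_edges (vertices m)"
    obtain a b where ab: "e = {a, b}" "a \<in> vertices m" "b \<in> vertices m" "a \<noteq> b"
      by (rule in_all_edgesE[OF e])
    have w': "sym_nonneg_on m ?w'" by (rule sym_nonneg_on_mesh[OF w s(2)])
    have "mesh ?n s (edge_weight w) e = w a b + w ?n a * w ?n b / s"
      using ab edge_weight_sym[OF w] sub star by (simp add: mesh_doubleton)
    also have "\<dots> = ?w' a b" using sw(1)[OF sub n] ab by simp
    also have "\<dots> = edge_weight ?w' e" using edge_weight_sym[OF w'] ab by simp
    finally show "mesh ?n s (edge_weight w) e = edge_weight ?w' e" .
  qed
  finally show ?thesis .
qed

text \<open>
  The state of the elimination when the vertices above \<open>k\<close> are gone: \<open>W\<close> and \<open>D\<close> hold the value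
  and the derivative, at \<open>t = 1\<close>, of a curve of weights on the remaining vertices that starts from
  the entrywise powers \<open>\<omega> powr t\<close>. The accumulated star sums form the factor \<open>S\<close>, and \<open>r\<close> is
  \<open>ln S - S' / S\<close>, which turns products of curves into sums.
\<close>

definition elimination_state ::
  "(nat \<Rightarrow> nat \<Rightarrow> real) \<Rightarrow> nat \<Rightarrow> nat \<Rightarrow> (nat \<Rightarrow> nat \<Rightarrow> real) \<Rightarrow> (nat \<Rightarrow> nat \<Rightarrow> real) \<Rightarrow> real \<Rightarrow> bool" where
  "elimination_state \<omega> p k W D r \<longleftrightarrow> (\<exists>u S S'.
     (\<forall>t. sym_nonneg_on k (u t)) \<and>
     (\<forall>t. 0 < tree_sum (vertices k) (edge_weight (u t))) \<and>
     (\<forall>a\<in>vertices k. \<forall>b\<in>vertices k. u 1 a b = W a b \<and>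
        ((\<lambda>t. u t a b) has_real_derivative D a b) (at 1)) \<and>
     (\<forall>t. tree_sum (vertices p) (edge_weight (\<lambda>a b. \<omega> a b powr t)) =
        S t * tree_sum (vertices k) (edge_weight (u t))) \<and>
     (S has_real_derivative S') (at (1::real)) \<and> 0 < S 1 \<and> r = ln (S 1) - S' / S 1)"

text \<open>The star sum of the curve at time \<open>t\<close> moves into the factor
  \<open>S\<close>. Both \<open>ln S\<close> and the logarithmic derivative turn products into sums,
  so \<open>r\<close> grows by \<open>ln s - ds / s\<close>. \<open>D'\<close> is the quotient rule
  for the mesh weights, and \<open>0 < s\<close> is part of the conclusion because the program must
  not divide by zero.\<close>

lemma elimination_state_step:
  assumes st: "elimination_state \<omega> p (Suc m) W D r" and m: "1 \<le> m"
    and s: "s = (\<Sum>j\<in>vertices m. W (Suc m) j)"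
    and ds: "ds = (\<Sum>j\<in>vertices m. D (Suc m) j)"
    and W': "\<And>a b. a \<in> vertices m \<Longrightarrow> b \<in> vertices m \<Longrightarrow>
      W' a b = W a b + W a (Suc m) * W (Suc m) b / s"
    and D': "\<And>a b. a \<in> vertices m \<Longrightarrow> b \<in> vertices m \<Longrightarrow>
      D' a b = D a b + ((D a (Suc m) * W (Suc m) b + W a (Suc m) * D (Suc m) b) -
        W a (Suc m) * W (Suc m) b * ds / s) / s"
  shows "0 < s \<and> elimination_state \<omega> p m W' D' (r + (ln s - ds / s))"
proof -
  let ?n = "Suc m"
  obtain u S S' where u: "\<And>t. sym_nonneg_on ?n (u t)"
      and pos: "\<And>t. 0 < tree_sum (vertices ?n) (edge_weight (u t))"
      and u1: "\<And>a b. a \<in> vertices ?n \<Longrightarrow> b \<in> vertices ?n \<Longrightarrow> u 1 a b = W a b"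
      and du: "\<And>a b. a \<in> vertices ?n \<Longrightarrow> b \<in> vertices ?n \<Longrightarrow>
        ((\<lambda>t. u t a b) has_real_derivative D a b) (at 1)"
      and Z: "\<And>t. tree_sum (vertices p) (edge_weight (\<lambda>a b. \<omega> a b powr t)) =
        S t * tree_sum (vertices ?n) (edge_weight (u t))"
      and S: "(S has_real_derivative S') (at 1)" "0 < S 1" "r = ln (S 1) - S' / S 1"
    using st unfolding elimination_state_def by blast
  have n: "?n \<in> vertices ?n" by (simp add: vertices_def)
  have sub: "a \<in> vertices ?n" if "a \<in> vertices m" for a using that by (simp add: vertices_Suc)
  define \<sigma> where "\<sigma> t = (\<Sum>j\<in>vertices m. u t ?n j)" for t
  define v where "v t a b = u t a b + u t a ?n * u t ?n b / \<sigma> t" for t a b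
  \<comment> \<open>Positivity is kept for every \<open>t\<close>, not only at 1, so that the
    factorization of the tree sum is an identity between functions of \<open>t\<close> and may be
    differentiated.\<close>
  have \<sigma>pos: "0 < \<sigma> t" for t unfolding \<sigma>_def by (rule star_sum_pos[OF u m pos])
  have \<sigma>1: "\<sigma> 1 = s" unfolding \<sigma>_def s by (rule sum.cong) (simp_all add: u1 n sub)
  have d\<sigma>: "(\<sigma> has_real_derivative ds) (at 1)"
    unfolding \<sigma>_def[abs_def] ds by (rule DERIV_sum) (simp add: du n sub)
  have s0: "0 < s" using \<sigma>pos[of 1] \<sigma>1 by simp
  have mesh: "tree_sum (vertices ?n) (edge_weight (u t)) = \<sigma> t * tree_sum (vertices m) (edge_weight (v t))" for t
    unfolding v_def[abs_def] by (rule star_mesh_matrix[OF u \<sigma>_def \<sigma>pos])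
  have "sym_nonneg_on m (v t)" for t
    unfolding v_def[abs_def] by (rule sym_nonneg_on_mesh[OF u \<sigma>pos])
  moreover have "0 < tree_sum (vertices m) (edge_weight (v t))" for t
    using mesh[of t] pos[of t] \<sigma>pos[of t] by (simp add: zero_less_mult_iff)
  moreover have "v 1 a b = W' a b" if "a \<in> vertices m" "b \<in> vertices m" for a b
    using that by (simp add: v_def u1 n sub \<sigma>1 W')
  moreover have "((\<lambda>t. v t a b) has_real_derivative D' a b) (at 1)"
    if ab: "a \<in> vertices m" "b \<in> vertices m" for a b
  proof -
    have "((\<lambda>t. v t a b) has_real_derivative
        D a b + ((D a ?n * u 1 ?n b + D ?n b * u 1 a ?n) * \<sigma> 1 - (u 1 a ?n * u 1 ?n b) * ds) / (\<sigma> 1 * \<sigma> 1)) (at 1)"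
      unfolding v_def using \<sigma>pos[of 1] ab
      by (intro DERIV_add DERIV_divide DERIV_mult du d\<sigma>) (simp_all add: n sub)
    moreover have "D a b + ((D a ?n * u 1 ?n b + D ?n b * u 1 a ?n) * \<sigma> 1 - (u 1 a ?n * u 1 ?n b) * ds) / (\<sigma> 1 * \<sigma> 1) = D' a b"
      using s0 ab by (simp add: D' \<sigma>1 u1 n sub field_simps)
    ultimately show ?thesis by simp
  qed
  moreover have "tree_sum (vertices p) (edge_weight (\<lambda>a b. \<omega> a b powr t)) =
      (S t * \<sigma> t) * tree_sum (vertices m) (edge_weight (v t))" for t
    using Z[of t] mesh[of t] by simp
  moreover have "((\<lambda>t. S t * \<sigma> t) has_real_derivative S' * \<sigma> 1 + ds * S 1) (at 1)"
    by (intro DERIV_mult S d\<sigma>)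
  moreover have "0 < S 1 * \<sigma> 1" using S(2) \<sigma>pos by simp
  moreover have "r + (ln s - ds / s) = ln (S 1 * \<sigma> 1) - (S' * \<sigma> 1 + ds * S 1) / (S 1 * \<sigma> 1)"
    using S(2,3) s0 by (simp add: \<sigma>1 ln_mult add_divide_distrib)
  ultimately have "elimination_state \<omega> p m W' D' (r + (ln s - ds / s))"
    unfolding elimination_state_def by (intro exI[of _ v] exI[of _ "\<lambda>t. S t * \<sigma> t"] exI) auto
  with s0 show ?thesis by simp
qed

section \<open>Start and end of the elimination\<close>

lemma weight_matrix_sym_nonneg: "weight_matrix p \<omega> \<Longrightarrow> sym_nonneg_on p \<omega>"
  unfolding weight_matrix_def sym_nonneg_on_def by (metis order_refl)

lemma sym_nonneg_powr: "sym_nonneg_on p \<omega> \<Longrightarrow> sym_nonneg_on p (\<lambda>a b. \<omega> a b powr t)"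
  unfolding sym_nonneg_on_def by (metis powr_ge_zero)

text \<open>For \<open>x = 0\<close> the library has \<open>0 powr t = 0\<close> for all
  \<open>t\<close>, so the curve is constant; this agrees with the convention for zero times its
  logarithm.\<close>

lemma has_real_derivative_powr_exponent:
  assumes "(0::real) \<le> x"
  shows "((\<lambda>t. x powr t) has_real_derivative x * ln x) (at 1)"
proof (cases "x = 0")
  case False
  then have "((\<lambda>t. exp (t * ln x)) has_real_derivative x * ln x) (at 1)"
    using assms by (auto intro!: derivative_eq_intros)
  then show ?thesis using False by (simp add: powr_def)
qed simp

text \<open>The graph of positive weights contains a spanning tree; its weight stays positive under
  every power, and no other tree contributes a negative term.\<close>

lemma tree_sum_powr_pos:
  assumes \<omega>: "weight_matrix p \<omega>" and p: "1 \<le> p"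
  shows "0 < tree_sum (vertices p) (edge_weight (\<lambda>a b. \<omega> a b powr t))"
proof -
  let ?u = "\<lambda>a b. \<omega> a b powr t"
  let ?E = "{{i, j} | i j. i \<in> vertices p \<and> j \<in> vertices p \<and> i \<noteq> j \<and> 0 < \<omega> i j}"
  have u: "sym_nonneg_on p ?u" by (intro sym_nonneg_powr weight_matrix_sym_nonneg \<omega>)
  have ne: "vertices p \<noteq> {}" using p by (simp add: vertices_def)
  have sub: "?E \<subseteq> all_edges (vertices p)" by (auto simp: all_edges_def)
  have con: "connected_graph (vertices p) ?E" using \<omega> unfolding weight_matrix_def by blast
  obtain T where T: "T \<in> trees_on (vertices p)" "T \<subseteq> ?E"
    by (rule connected_graph_contains_tree[OF finite_vertices ne sub con])
  have "0 < (\<Prod>e\<in>T. edge_weight ?u e)"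
  proof (rule prod_pos)
    fix e assume "e \<in> T"
    then obtain i j where "e = {i, j}" "i \<in> vertices p" "j \<in> vertices p" "0 < \<omega> i j"
      using T(2) by blast
    then show "0 < edge_weight ?u e" by (simp add: edge_weight_sym[OF u])
  qed
  moreover have "0 \<le> (\<Prod>e\<in>T'. edge_weight ?u e)" if "T' \<in> trees_on (vertices p)" for T'
    using that edge_weight_nonneg[OF u] by (intro prod_nonneg) (auto simp: trees_on_def)
  ultimately show ?thesis unfolding tree_sum_def
    using T(1) finite_trees_on[OF finite_vertices] by (intro sum_pos2[of _ T]) auto
qed

lemma elimination_state_init:
  assumes \<omega>: "weight_matrix p \<omega>" and p: "1 \<le> p"
    and W: "\<And>a b. a \<in> vertices p \<Longrightarrow> b \<in> vertices p \<Longrightarrow> W a b = \<omega> a b"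
    and D: "\<And>a b. a \<in> vertices p \<Longrightarrow> b \<in> vertices p \<Longrightarrow> D a b = \<omega> a b * ln (\<omega> a b)"
  shows "elimination_state \<omega> p p W D 0"
proof -
  have s: "sym_nonneg_on p \<omega>" using \<omega> by (rule weight_matrix_sym_nonneg)
  have 1: "\<omega> a b powr 1 = W a b" "((\<lambda>t. \<omega> a b powr t) has_real_derivative D a b) (at 1)"
    if "a \<in> vertices p" "b \<in> vertices p" for a b
    using has_real_derivative_powr_exponent[of "\<omega> a b"] sym_nonneg_onD(2)[OF s] that W D by simp_all
  show ?thesis
    unfolding elimination_state_def
    by (intro exI[of _ "\<lambda>t a b. \<omega> a b powr t"] exI[of _ "\<lambda>_. 1"] exI[of _ 0])
      (use 1 tree_sum_powr_pos[OF \<omega> p] sym_nonneg_powr[OF s] in auto)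
qed

text \<open>On one vertex the tree sum is 1, so \<open>S\<close> has become the whole partition
  function of the powers. Uniqueness of derivatives identifies the \<open>S'\<close> that the
  elimination carried along with the sum of \<open>?w T * ln (?w T)\<close>.\<close>

lemma elimination_state_final:
  assumes \<omega>: "weight_matrix p \<omega>" and p: "1 \<le> p" and st: "elimination_state \<omega> p 1 W D r"
  shows "r = posterior_entropy p \<omega>"
proof -
  let ?T = "trees_on (vertices p)" and ?w = "tree_weight \<omega>"
  have sp: "spanning_trees p = ?T" by (rule spanning_trees_eq[OF p])
  have s: "sym_nonneg_on p \<omega>" using \<omega> by (rule weight_matrix_sym_nonneg)
  obtain u S S' where Z: "\<And>t. tree_sum (vertices p) (edge_weight (\<lambda>a b. \<omega> a b powr t)) =
        S t * tree_sum (vertices 1) (edge_weight (u t))"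
      and S: "(S has_real_derivative S') (at 1)" "0 < S 1" "r = ln (S 1) - S' / S 1"
    using st unfolding elimination_state_def by blast
  have nn: "0 \<le> edge_weight \<omega> e" if "T \<in> ?T" "e \<in> T" for T e
    using that edge_weight_nonneg[OF s] by (auto simp: trees_on_def)
  have wn: "0 \<le> ?w T" if "T \<in> ?T" for T
    unfolding tree_weight_def using nn[OF that] by (rule prod_nonneg)
  have St: "S t = (\<Sum>T\<in>?T. ?w T powr t)" for t
  proof -
    have "vertices 1 = {1}" by (auto simp: vertices_def)
    then have "S t = tree_sum (vertices p) (edge_weight (\<lambda>a b. \<omega> a b powr t))"
      using Z[of t] by (simp add: tree_sum_singleton)
    \<comment> \<open>A product of powers of edge weights is the power of the tree weight.\<close>
    also have "\<dots> = (\<Sum>T\<in>?T. ?w T powr t)"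
      unfolding tree_sum_def tree_weight_def
      using nn by (intro sum.cong refl) (simp add: prod_powr_distrib edge_weight_def)
    finally show ?thesis .
  qed
  have "(S has_real_derivative (\<Sum>T\<in>?T. ?w T * ln (?w T))) (at 1)"
    unfolding St[abs_def] by (rule DERIV_sum) (rule has_real_derivative_powr_exponent[OF wn])
  then have S': "S' = (\<Sum>T\<in>?T. ?w T * ln (?w T))" using S(1) by (metis DERIV_unique)
  have S1: "S 1 = sum ?w ?T" unfolding St by (rule sum.cong) (simp_all add: wn)
  then have pf: "partition_function p \<omega> = S 1" by (simp add: partition_function_def sp)
  have "posterior_entropy p \<omega> = - (\<Sum>T\<in>?T. ?w T * ln (?w T) / S 1 - ?w T * (ln (S 1) / S 1))"
    unfolding posterior_entropy_def sp posterior_def pf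
  proof (intro arg_cong[of _ _ uminus] sum.cong refl)
    fix T assume T: "T \<in> ?T"
    show "(if ?w T / S 1 = 0 then 0 else ?w T / S 1 * ln (?w T / S 1)) =
        ?w T * ln (?w T) / S 1 - ?w T * (ln (S 1) / S 1)"
    proof (cases "?w T = 0")
      case False
      then have "0 < ?w T" using wn[OF T] by simp
      then show ?thesis using S(2) by (simp add: ln_div field_simps)
    qed simp
  qed
  also have "\<dots> = - (S' / S 1 - S 1 * (ln (S 1) / S 1))"
    by (simp add: sum_subtractf S' S1 sum_divide_distrib sum_distrib_right)
  also have "\<dots> = r" using S(2,3) by simp
  finally show ?thesis by simp
qed

section \<open>The program\<close>

lemma iupdate_simps [simp]:
  "fst (iupdate x n s) y = (if y = x then n else fst s y)"
  "snd (iupdate x n s) = snd s"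
  by (simp_all add: iupdate_def)

lemma rupdate_simps [simp]:
  "fst (rupdate A m n r s) = fst s"
  "snd (rupdate A m n r s) B a b = (if B = A \<and> a = m \<and> b = n then r else snd s B a b)"
  by (simp_all add: rupdate_def)

text \<open>A total-correctness judgement. The cost is bounded instead of exact because the number
  of operations depends on which weights are zero.\<close>

definition runs :: "com \<Rightarrow> state \<Rightarrow> nat \<Rightarrow> (state \<Rightarrow> bool) \<Rightarrow> bool" where
  "runs c s N Q \<longleftrightarrow> (\<exists>n t. exec c s n t \<and> n \<le> N \<and> Q t)"

lemma runs_weaken: "runs c s M P \<Longrightarrow> M \<le> N \<Longrightarrow> (\<And>t. P t \<Longrightarrow> Q t) \<Longrightarrow> runs c s N Q"
  unfolding runs_def by (meson order_trans)

lemma runs_Skip: "Q s \<Longrightarrow> runs Skip s N Q"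
  unfolding runs_def using exec.Skip by blast

lemma runs_IAssign: "Q (iupdate x (ival a s) s) \<Longrightarrow> runs (IAssign x a) s N Q"
  unfolding runs_def using exec.IAssign by blast

lemma runs_RAssign:
  "rdefined e s \<Longrightarrow> Q (rupdate A (ival i s) (ival j s) (rval e s) s) \<Longrightarrow> rcost e \<le> N \<Longrightarrow>
    runs (RAssign A i j e) s N Q"
  unfolding runs_def using exec.RAssign by blast

lemma runs_Seq:
  assumes "runs c1 s M P" "\<And>t. P t \<Longrightarrow> runs c2 t N Q" "M + N \<le> K"
  shows "runs (Seq c1 c2) s K Q"
proof -
  obtain m t where t: "exec c1 s m t" "m \<le> M" "P t" using assms(1) unfolding runs_def by blast
  obtain n u where u: "exec c2 t n u" "n \<le> N" "Q u" using assms(2)[OF t(3)] unfolding runs_def by blast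
  have "exec (Seq c1 c2) s (m + n) u" using t(1) u(1) by (rule exec.Seq)
  moreover have "m + n \<le> K" using t(2) u(2) assms(3) by linarith
  ultimately show ?thesis using u(3) unfolding runs_def by blast
qed

lemma runs_Seq_RAssign:
  assumes "rdefined e s" "runs c (rupdate A (ival i s) (ival j s) (rval e s) s) N Q" "rcost e + N \<le> K"
  shows "runs (Seq (RAssign A i j e) c) s K Q"
  by (rule runs_Seq[OF runs_RAssign[where Q = "\<lambda>t. t = rupdate A (ival i s) (ival j s) (rval e s) s"]])
    (use assms in auto)

lemma runs_Cond:
  assumes "tdefined b s" "runs (if tval b s then c1 else c2) s N Q" "tcost b + N \<le> K"
  shows "runs (Cond b c1 c2) s K Q"
proof -
  obtain n t where t: "exec (if tval b s then c1 else c2) s n t" "n \<le> N" "Q t"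
    using assms(2) unfolding runs_def by blast
  have "exec (Cond b c1 c2) s (tcost b + n) t"
    using t(1) assms(1) exec.CondTrue[of b s c1 n t c2] exec.CondFalse[of b s c2 n t c1]
    by (cases "tval b s") simp_all
  moreover have "tcost b + n \<le> K" using t(2) assms(3) by linarith
  ultimately show ?thesis using t(3) unfolding runs_def by blast
qed

text \<open>The bound \<open>hi\<close> is exclusive and is evaluated anew at every test, so the
  rule below asks the invariant to fix its value.\<close>

definition for_loop :: "string \<Rightarrow> index_exp \<Rightarrow> com \<Rightarrow> com" where
  "for_loop x hi c = Seq (IAssign x (INum 1))
     (While (ILess (IVar x) hi) (Seq c (IAssign x (IAdd (IVar x) (INum 1)))))"

text \<open>Index tests and index assignments cost nothing, so only the \<open>h - 1\<close> runs of
  the body are charged.\<close>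

lemma runs_for_loop:
  assumes init: "I 1 (iupdate x 1 s)" and h: "1 \<le> h"
    and inv: "\<And>j t. I j t \<Longrightarrow> fst t x = j \<and> ival hi t = h"
    and body: "\<And>j t. 1 \<le> j \<Longrightarrow> j < h \<Longrightarrow> I j t \<Longrightarrow>
      runs c t N (\<lambda>t'. fst t' x = j \<and> I (Suc j) (iupdate x (Suc j) t'))"
    and K: "(h - 1) * N \<le> K"
    and post: "\<And>t. I h t \<Longrightarrow> Q t"
  shows "runs (for_loop x hi c) s K Q"
proof -
  let ?b = "ILess (IVar x) hi" and ?c = "Seq c (IAssign x (IAdd (IVar x) (INum 1)))"
  have while: "runs (While ?b ?c) t ((h - j) * N) (I h)" if "1 \<le> j" "j \<le> h" "I j t" for j t
    using that
  proof (induction "h - j" arbitrary: j t)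
    case 0
    then have "j = h" by simp
    then have "I h t" "\<not> tval ?b t" using 0 inv[of h t] by simp_all
    then show ?case
      unfolding runs_def using exec.WhileFalse[of ?b t ?c] by (intro exI[of _ 0] exI[of _ t]) simp
  next
    case (Suc d)
    then have j: "j < h" by simp
    have tv: "tval ?b t" using inv[OF Suc.prems(3)] j by simp
    obtain m u where u: "exec c t m u" "m \<le> N" "fst u x = j" "I (Suc j) (iupdate x (Suc j) u)"
      using body[OF Suc.prems(1) j Suc.prems(3)] unfolding runs_def by blast
    have "exec (IAssign x (IAdd (IVar x) (INum 1))) u 0 (iupdate x (Suc j) u)"
      using exec.IAssign[of x "IAdd (IVar x) (INum 1)" u] u(3) by simp
    then have c: "exec ?c t m (iupdate x (Suc j) u)" using exec.Seq[OF u(1)] by fastforce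
    have "d = h - Suc j" using Suc.hyps(2) by simp
    then obtain n v where v: "exec (While ?b ?c) (iupdate x (Suc j) u) n v" "n \<le> (h - Suc j) * N" "I h v"
      using Suc.hyps(1)[of "Suc j" "iupdate x (Suc j) u"] u(4) j unfolding runs_def by auto
    have "exec (While ?b ?c) t (tcost ?b + m + n) v"
      by (rule exec.WhileTrue[OF _ tv c v(1)]) simp
    moreover have "tcost ?b + m + n \<le> (h - j) * N"
    proof -
      have "h - j = Suc (h - Suc j)" using j by simp
      then show ?thesis using u(2) v(2) by simp
    qed
    ultimately show ?case using v(3) unfolding runs_def by blast
  qed
  show ?thesis
    unfolding for_loop_def
  proof (rule runs_Seq[where M = 0 and P = "I 1"])
    show "runs (IAssign x (INum 1)) s 0 (I 1)" by (rule runs_IAssign) (use init in simp)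
    show "runs (While ?b ?c) t K Q" if "I 1 t" for t
      by (rule runs_weaken[OF while[OF _ h that]]) (use K post in auto)
  qed simp
qed

section \<open>The elimination as a program\<close>

definition cell :: "string \<Rightarrow> real_exp" where
  "cell A = RCell A (INum 0) (INum 0)"

abbreviation set_cell :: "string \<Rightarrow> real_exp \<Rightarrow> com" where
  "set_cell A e \<equiv> RAssign A (INum 0) (INum 0) e"

abbreviation succ_p :: index_exp where
  "succ_p \<equiv> IAdd (IVar ''p'') (INum 1)"

text \<open>In round \<open>l\<close> of the elimination the last remaining vertex is \<open>p + 1 - l\<close>.\<close>

abbreviation last_vertex :: index_exp where
  "last_vertex \<equiv> ISub succ_p (IVar ''l'')"

text \<open>The test guards the logarithm. Entries of weight zero keep the initial value 0 of
  \<open>d\<close>, which is their correct derivative.\<close>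

definition init_loop :: com where
  "init_loop = for_loop ''i'' succ_p (for_loop ''j'' succ_p
     (Cond (RLess (RNum 0) (RCell ''w'' (IVar ''i'') (IVar ''j'')))
       (RAssign ''d'' (IVar ''i'') (IVar ''j'')
         (RMul (RCell ''w'' (IVar ''i'') (IVar ''j'')) (RLog (RCell ''w'' (IVar ''i'') (IVar ''j'')))))
       Skip))"

definition star_sums :: com where
  "star_sums = Seq (set_cell ''s'' (RNum 0)) (Seq (set_cell ''t'' (RNum 0))
     (for_loop ''j'' last_vertex
       (Seq (set_cell ''s'' (RAdd (cell ''s'') (RCell ''w'' last_vertex (IVar ''j''))))
            (set_cell ''t'' (RAdd (cell ''t'') (RCell ''d'' last_vertex (IVar ''j'')))))))"

definition add_log_term :: com where
  "add_log_term = set_cell ''out''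
     (RAdd (cell ''out'') (RSub (RLog (cell ''s'')) (RDiv (cell ''t'') (cell ''s''))))"

definition mesh_d :: real_exp where
  "mesh_d =
     (let wi = RCell ''w'' (IVar ''i'') last_vertex; wj = RCell ''w'' last_vertex (IVar ''j'');
          di = RCell ''d'' (IVar ''i'') last_vertex; dj = RCell ''d'' last_vertex (IVar ''j'')
      in RAdd (RCell ''d'' (IVar ''i'') (IVar ''j''))
           (RDiv (RSub (RAdd (RMul di wj) (RMul wi dj))
                       (RDiv (RMul (RMul wi wj) (cell ''t'')) (cell ''s''))) (cell ''s'')))"

definition mesh_w :: real_exp where
  "mesh_w = RAdd (RCell ''w'' (IVar ''i'') (IVar ''j''))
     (RDiv (RMul (RCell ''w'' (IVar ''i'') last_vertex) (RCell ''w'' last_vertex (IVar ''j'')))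
       (cell ''s''))"

text \<open>The update can be done in place: apart from its own cell and the two accumulated sums,
  each assignment reads only the row and column of the last vertex, which the loops never
  overwrite.\<close>

definition mesh_loop :: com where
  "mesh_loop = for_loop ''i'' last_vertex (for_loop ''j'' last_vertex
     (Seq (RAssign ''d'' (IVar ''i'') (IVar ''j'') mesh_d)
          (RAssign ''w'' (IVar ''i'') (IVar ''j'') mesh_w)))"

text \<open>The outer bound \<open>p\<close> is exclusive, so \<open>p - 1\<close> rounds are made
  and one vertex is left.\<close>

definition entropy_program :: com where
  "entropy_program = Seq init_loop
     (for_loop ''l'' (IVar ''p'') (Seq star_sums (Seq add_log_term mesh_loop)))"

section \<open>Correctness and cost of the program\<close>

lemma runs_init_loop:
  assumes "fst s ''p'' = p" "\<And>a b. snd s ''d'' a b = 0"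
    "\<And>a b. a \<in> vertices p \<Longrightarrow> b \<in> vertices p \<Longrightarrow> 0 \<le> snd s ''w'' a b"
  shows "runs init_loop s (3 * p ^ 2) (\<lambda>t. fst t ''p'' = p \<and>
    (\<forall>A. A \<noteq> ''d'' \<longrightarrow> snd t A = snd s A) \<and>
    (\<forall>a\<in>vertices p. \<forall>b\<in>vertices p. snd t ''d'' a b = snd s ''w'' a b * ln (snd s ''w'' a b)))"
proof -
  \<comment> \<open>The cells before \<open>(i, j)\<close> in row order are filled, the later ones
    are still zero.\<close>
  define I where "I i j t \<longleftrightarrow> fst t ''p'' = p \<and> fst t ''i'' = i \<and>
    (\<forall>A. A \<noteq> ''d'' \<longrightarrow> snd t A = snd s A) \<and>
    (\<forall>a\<in>vertices p. \<forall>b\<in>vertices p. snd t ''d'' a b =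
      (if a < i \<or> a = i \<and> b < j then snd s ''w'' a b * ln (snd s ''w'' a b) else 0))" for i j t
  have inner: "runs (for_loop ''j'' succ_p
     (Cond (RLess (RNum 0) (RCell ''w'' (IVar ''i'') (IVar ''j'')))
       (RAssign ''d'' (IVar ''i'') (IVar ''j'')
         (RMul (RCell ''w'' (IVar ''i'') (IVar ''j'')) (RLog (RCell ''w'' (IVar ''i'') (IVar ''j'')))))
       Skip)) t (3 * p) (\<lambda>t'. fst t' ''i'' = i \<and> I (Suc i) 1 (iupdate ''i'' (Suc i) t'))"
    if i: "1 \<le> i" "i < p + 1" and I: "I i 1 t" for i t
  \<comment> \<open>Three operations per cell: a comparison, a logarithm and a
    multiplication.\<close>
  proof (rule runs_for_loop[where I = "\<lambda>j t. I i j t \<and> fst t ''j'' = j" and h = "p + 1" and N = 3])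
    fix j u assume j: "1 \<le> j" "j < p + 1" and u: "I i j u \<and> fst u ''j'' = j"
    have ij: "i \<in> vertices p" "j \<in> vertices p" using i j by (auto simp: vertices_def)
    have w: "snd u ''w'' = snd s ''w''" using u by (simp add: I_def)
    show "runs (Cond (RLess (RNum 0) (RCell ''w'' (IVar ''i'') (IVar ''j'')))
       (RAssign ''d'' (IVar ''i'') (IVar ''j'')
         (RMul (RCell ''w'' (IVar ''i'') (IVar ''j'')) (RLog (RCell ''w'' (IVar ''i'') (IVar ''j'')))))
       Skip) u 3 (\<lambda>t'. fst t' ''j'' = j \<and>
         (I i (Suc j) (iupdate ''j'' (Suc j) t') \<and> fst (iupdate ''j'' (Suc j) t') ''j'' = Suc j))"
    proof (rule runs_Cond[where N = 2])
      show "runs (if tval (RLess (RNum 0) (RCell ''w'' (IVar ''i'') (IVar ''j''))) u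
        then RAssign ''d'' (IVar ''i'') (IVar ''j'')
         (RMul (RCell ''w'' (IVar ''i'') (IVar ''j'')) (RLog (RCell ''w'' (IVar ''i'') (IVar ''j''))))
        else Skip) u 2 (\<lambda>t'. fst t' ''j'' = j \<and>
         (I i (Suc j) (iupdate ''j'' (Suc j) t') \<and> fst (iupdate ''j'' (Suc j) t') ''j'' = Suc j))"
      proof (cases "0 < snd s ''w'' i j")
        case True
        then show ?thesis
          using u w by (auto intro!: runs_RAssign simp: I_def fun_eq_iff less_Suc_eq)
      next
        case False
        then have "snd s ''w'' i j = 0" using assms(3)[OF ij] by simp
        then show ?thesis
          using u w by (auto intro!: runs_Skip simp: I_def fun_eq_iff less_Suc_eq)
      qed
    qed simp_all
  next
    fix u assume "I i (p + 1) u \<and> fst u ''j'' = p + 1"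
    then show "fst u ''i'' = i \<and> I (Suc i) 1 (iupdate ''i'' (Suc i) u)"
      by (auto simp: I_def vertices_def less_Suc_eq)
  qed (use I in \<open>auto simp: I_def\<close>)
  show ?thesis
    unfolding init_loop_def
  proof (rule runs_for_loop[where I = "\<lambda>i t. I i 1 t" and h = "p + 1" and N = "3 * p"])
    show "I 1 1 (iupdate ''i'' 1 s)" using assms(1,2) by (auto simp: I_def vertices_def)
  qed (use inner in \<open>auto simp: I_def vertices_def power2_eq_square\<close>)
qed

lemma runs_star_sums:
  assumes "fst s ''p'' = p" "fst s ''l'' = l" "l \<le> p" "k = p + 1 - l"
  shows "runs star_sums s (2 * p) (\<lambda>t. fst t ''p'' = p \<and> fst t ''l'' = l \<and>
    (\<forall>A. A \<noteq> ''s'' \<longrightarrow> A \<noteq> ''t'' \<longrightarrow> snd t A = snd s A) \<and>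
    snd t ''s'' 0 0 = (\<Sum>j\<in>{1..<k}. snd s ''w'' k j) \<and>
    snd t ''t'' 0 0 = (\<Sum>j\<in>{1..<k}. snd s ''d'' k j))"
proof -
  define I where "I j t \<longleftrightarrow> fst t ''p'' = p \<and> fst t ''l'' = l \<and>
    (\<forall>A. A \<noteq> ''s'' \<longrightarrow> A \<noteq> ''t'' \<longrightarrow> snd t A = snd s A) \<and>
    snd t ''s'' 0 0 = (\<Sum>j\<in>{1..<j}. snd s ''w'' k j) \<and>
    snd t ''t'' 0 0 = (\<Sum>j\<in>{1..<j}. snd s ''d'' k j)" for j :: nat and t
  have k: "1 \<le> k" "k \<le> p + 1 - l" using assms by auto
  let ?body = "Seq (set_cell ''s'' (RAdd (cell ''s'') (RCell ''w'' last_vertex (IVar ''j''))))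
            (set_cell ''t'' (RAdd (cell ''t'') (RCell ''d'' last_vertex (IVar ''j''))))"
  have loop: "runs (for_loop ''j'' last_vertex ?body) t (2 * p) (I k)" if I: "I 1 t" for t
  proof (rule runs_for_loop[where I = "\<lambda>j t. I j t \<and> fst t ''j'' = j" and h = k and N = 2])
    fix j u assume j: "1 \<le> j" "j < k" and u: "I j u \<and> fst u ''j'' = j"
    show "runs ?body u 2 (\<lambda>t'. fst t' ''j'' = j \<and>
      (I (Suc j) (iupdate ''j'' (Suc j) t') \<and> fst (iupdate ''j'' (Suc j) t') ''j'' = Suc j))"
      by (rule runs_Seq_RAssign[where N = 1], simp add: cell_def, rule runs_RAssign)
        (use j u assms(4) in \<open>auto simp: I_def cell_def fun_eq_iff\<close>)
  qed (use I k assms in \<open>auto simp: I_def\<close>)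
  show ?thesis
    unfolding star_sums_def
    by (rule runs_Seq_RAssign[where N = "2 * p"], simp, rule runs_Seq_RAssign[where N = "2 * p"], simp,
        rule runs_weaken[OF loop])
      (use assms in \<open>auto simp: I_def fun_eq_iff\<close>)
qed

lemma runs_mesh_loop:
  assumes s: "fst s ''p'' = p" "fst s ''l'' = l" and l: "l \<le> p" and k: "k = p + 1 - l"
    and pos: "snd s ''s'' 0 0 \<noteq> 0"
  defines "W \<equiv> snd s ''w''" and "D \<equiv> snd s ''d''"
    and "\<sigma> \<equiv> snd s ''s'' 0 0" and "\<tau> \<equiv> snd s ''t'' 0 0"
  defines "W' \<equiv> \<lambda>a b. W a b + W a k * W k b / \<sigma>"
    and "D' \<equiv> \<lambda>a b. D a b + (D a k * W k b + W a k * D k b - W a k * W k b * \<tau> / \<sigma>) / \<sigma>"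
  shows "runs mesh_loop s (12 * p ^ 2) (\<lambda>t. fst t ''p'' = p \<and> fst t ''l'' = l \<and>
    snd t ''out'' = snd s ''out'' \<and>
    (\<forall>a\<in>{1..<k}. \<forall>b\<in>{1..<k}. snd t ''w'' a b = W' a b \<and> snd t ''d'' a b = D' a b))"
proof -
  \<comment> \<open>\<open>R i j\<close> marks the cells already rewritten; with
    \<open>b < k\<close> it leaves out column \<open>k\<close>, and row \<open>k\<close> is not
    reached while \<open>i < k\<close>.\<close>
  define R where "R i j a b \<longleftrightarrow> 1 \<le> a \<and> 1 \<le> b \<and> b < k \<and> (a < i \<or> a = i \<and> b < j)" for i j a b :: nat
  define I where "I i j t \<longleftrightarrow> fst t ''p'' = p \<and> fst t ''l'' = l \<and> fst t ''i'' = i \<and>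
    (\<forall>A. A \<noteq> ''d'' \<longrightarrow> A \<noteq> ''w'' \<longrightarrow> snd t A = snd s A) \<and>
    (\<forall>a b. snd t ''w'' a b = (if R i j a b then W' a b else W a b)) \<and>
    (\<forall>a b. snd t ''d'' a b = (if R i j a b then D' a b else D a b))" for i j :: nat and t
  let ?body = "Seq (RAssign ''d'' (IVar ''i'') (IVar ''j'') mesh_d)
          (RAssign ''w'' (IVar ''i'') (IVar ''j'') mesh_w)"
  have kp: "1 \<le> k" using k l by simp
  have inner: "runs (for_loop ''j'' last_vertex ?body) t (12 * p)
      (\<lambda>t'. fst t' ''i'' = i \<and> I (Suc i) 1 (iupdate ''i'' (Suc i) t'))"
    if i: "1 \<le> i" "i < k" and I: "I i 1 t" for i t
  \<comment> \<open>Nine operations for \<open>mesh_d\<close> and three for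
    \<open>mesh_w\<close>.\<close>
  proof (rule runs_for_loop[where I = "\<lambda>j t. I i j t \<and> fst t ''j'' = j" and h = k and N = 12])
    fix j u assume j: "1 \<le> j" "j < k" and "I i j u \<and> fst u ''j'' = j"
    then have u: "fst u ''p'' = p" "fst u ''l'' = l" "fst u ''i'' = i" "fst u ''j'' = j"
        "\<And>A. A \<noteq> ''d'' \<Longrightarrow> A \<noteq> ''w'' \<Longrightarrow> snd u A = snd s A"
        "\<And>a b. snd u ''w'' a b = (if R i j a b then W' a b else W a b)"
        "\<And>a b. snd u ''d'' a b = (if R i j a b then D' a b else D a b)"
      by (simp_all add: I_def)
    \<comment> \<open>The cells about to be read still hold the values from the start of the
      round.\<close>
    have old: "\<not> R i j i j" "\<not> R i j i k" "\<not> R i j k j" using i by (simp_all add: R_def)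
    have R_Suc: "R i (Suc j) a b \<longleftrightarrow> R i j a b \<or> a = i \<and> b = j" for a b
      using i j by (auto simp: R_def)
    have kk: "ival last_vertex u = k" using u k by simp
    let ?u = "rupdate ''d'' (ival (IVar ''i'') u) (ival (IVar ''j'') u) (rval mesh_d u) u"
    have d: "rval mesh_d u = D' i j" "rdefined mesh_d u"
      using u(1,2) k old pos
      by (simp_all add: mesh_d_def Let_def cell_def u D'_def \<sigma>_def \<tau>_def)
    have w: "rval mesh_w ?u = W' i j" "rdefined mesh_w ?u"
      using u(1,2) k old pos
      by (simp_all add: mesh_w_def cell_def u W'_def \<sigma>_def)
    show "runs ?body u 12 (\<lambda>t'. fst t' ''j'' = j \<and>
      (I i (Suc j) (iupdate ''j'' (Suc j) t') \<and> fst (iupdate ''j'' (Suc j) t') ''j'' = Suc j))"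
    proof (rule runs_Seq_RAssign[where N = 3, OF d(2) runs_RAssign[OF w(2)]])
      let ?v = "rupdate ''w'' (ival (IVar ''i'') ?u) (ival (IVar ''j'') ?u) (rval mesh_w ?u) ?u"
      have "snd ?v ''w'' a b = (if R i (Suc j) a b then W' a b else W a b)" for a b
        unfolding w by (simp add: u R_Suc)
      moreover have "snd ?v ''d'' a b = (if R i (Suc j) a b then D' a b else D a b)" for a b
        by (simp add: u R_Suc d)
      moreover have "snd ?v A = snd s A" if "A \<noteq> ''d''" "A \<noteq> ''w''" for A
        using that u(5) by (simp add: fun_eq_iff)
      ultimately show "fst ?v ''j'' = j \<and> (I i (Suc j) (iupdate ''j'' (Suc j) ?v) \<and>
          fst (iupdate ''j'' (Suc j) ?v) ''j'' = Suc j)"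
        unfolding I_def by (simp add: u(1-4))
    qed (simp_all add: mesh_d_def mesh_w_def cell_def Let_def)
  next
    fix u assume "I i k u \<and> fst u ''j'' = k"
    moreover have "R i k = R (Suc i) 1" by (auto simp: R_def fun_eq_iff)
    ultimately show "fst u ''i'' = i \<and> I (Suc i) 1 (iupdate ''i'' (Suc i) u)"
      by (simp add: I_def)
  next
    have "R i (Suc 0) = R i 1" by simp
    then show "I i 1 (iupdate ''j'' 1 t) \<and> fst (iupdate ''j'' 1 t) ''j'' = 1"
      using I by (simp add: I_def)
  next
    show "(k - 1) * 12 \<le> 12 * p" using k l by (cases l) (auto simp: algebra_simps)
  qed (use kp k in \<open>auto simp: I_def\<close>)
  show ?thesis
    unfolding mesh_loop_def
  proof (rule runs_for_loop[where I = "\<lambda>i t. I i 1 t" and h = k and N = "12 * p"])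
    show "I 1 1 (iupdate ''i'' 1 s)" using s by (auto simp: I_def R_def W_def D_def)
  next
    have "(k - 1) * (12 * p) \<le> p * (12 * p)" using k l by (intro mult_right_mono) (cases l, auto)
    then show "(k - 1) * (12 * p) \<le> 12 * p ^ 2" by (simp add: power2_eq_square)
  next
    fix t assume "I k 1 t"
    moreover have "R k 1 a b" if "a \<in> {1..<k}" "b \<in> {1..<k}" for a b using that by (auto simp: R_def)
    ultimately show "fst t ''p'' = p \<and> fst t ''l'' = l \<and> snd t ''out'' = snd s ''out'' \<and>
      (\<forall>a\<in>{1..<k}. \<forall>b\<in>{1..<k}. snd t ''w'' a b = W' a b \<and> snd t ''d'' a b = D' a b)"
      by (simp add: I_def)
  qed (use inner kp k in \<open>auto simp: I_def\<close>)
qed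

lemma runs_elimination_round:
  assumes s: "fst s ''p'' = p" "fst s ''l'' = l" and l: "1 \<le> l" "l < p"
    and st: "elimination_state \<omega> p (p + 1 - l) (snd s ''w'') (snd s ''d'') (snd s ''out'' 0 0)"
  shows "runs (Seq star_sums (Seq add_log_term mesh_loop)) s (2 * p + (4 + 12 * p ^ 2))
    (\<lambda>t. fst t ''p'' = p \<and> fst t ''l'' = l \<and>
      elimination_state \<omega> p (p - l) (snd t ''w'') (snd t ''d'') (snd t ''out'' 0 0))"
proof -
  define m where "m = p - l"
  have m: "p + 1 - l = Suc m" "1 \<le> m" using l by (simp_all add: m_def)
  let ?W = "snd s ''w''" and ?D = "snd s ''d''" and ?r = "snd s ''out'' 0 0"
  have V: "{1..<Suc m} = vertices m" by (auto simp: vertices_def)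
  define \<sigma> where "\<sigma> = (\<Sum>j\<in>vertices m. ?W (Suc m) j)"
  define \<tau> where "\<tau> = (\<Sum>j\<in>vertices m. ?D (Suc m) j)"
  note step = elimination_state_step[OF st[unfolded m(1)] m(2) \<sigma>_def \<tau>_def]
  \<comment> \<open>Positivity of the star sum is needed before the round is executed, since the
    logarithm and the divisions must be defined.\<close>
  have \<sigma>: "0 < \<sigma>" using step[OF refl refl] by blast
  show ?thesis
  proof (rule runs_Seq[OF runs_star_sums[OF s less_imp_le[OF l(2)] m(1)[symmetric]]])
    fix t assume "fst t ''p'' = p \<and> fst t ''l'' = l \<and>
      (\<forall>A. A \<noteq> ''s'' \<longrightarrow> A \<noteq> ''t'' \<longrightarrow> snd t A = snd s A) \<and>
      snd t ''s'' 0 0 = (\<Sum>j\<in>{1..<Suc m}. ?W (Suc m) j) \<and>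
      snd t ''t'' 0 0 = (\<Sum>j\<in>{1..<Suc m}. ?D (Suc m) j)"
    then have t: "fst t ''p'' = p" "fst t ''l'' = l"
        "\<And>A. A \<noteq> ''s'' \<Longrightarrow> A \<noteq> ''t'' \<Longrightarrow> snd t A = snd s A"
        "snd t ''s'' 0 0 = \<sigma>" "snd t ''t'' 0 0 = \<tau>"
      unfolding V \<sigma>_def \<tau>_def by blast+
    let ?e = "RAdd (cell ''out'') (RSub (RLog (cell ''s'')) (RDiv (cell ''t'') (cell ''s'')))"
    let ?u = "rupdate ''out'' (ival (INum 0) t) (ival (INum 0) t) (rval ?e t) t"
    have e: "rval ?e t = ?r + (ln \<sigma> - \<tau> / \<sigma>)" "rdefined ?e t"
      using t \<sigma> by (simp_all add: cell_def)
    have u: "fst ?u ''p'' = p" "fst ?u ''l'' = l" "snd ?u ''w'' = ?W" "snd ?u ''d'' = ?D"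
        "snd ?u ''s'' 0 0 = \<sigma>" "snd ?u ''t'' 0 0 = \<tau>"
        "snd ?u ''out'' 0 0 = ?r + (ln \<sigma> - \<tau> / \<sigma>)"
      using t e(1) by (simp_all add: fun_eq_iff)
    \<comment> \<open>The summand 4 pays for the addition, subtraction, logarithm and division of
      \<open>add_log_term\<close>.\<close>
    show "runs (Seq add_log_term mesh_loop) t (4 + 12 * p ^ 2) (\<lambda>t. fst t ''p'' = p \<and> fst t ''l'' = l \<and>
      elimination_state \<omega> p (p - l) (snd t ''w'') (snd t ''d'') (snd t ''out'' 0 0))"
      unfolding add_log_term_def
    proof (rule runs_Seq_RAssign[where N = "12 * p ^ 2", OF e(2)], rule runs_weaken)
      show "runs mesh_loop ?u (12 * p ^ 2) (\<lambda>t. fst t ''p'' = p \<and> fst t ''l'' = l \<and>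
        snd t ''out'' = snd ?u ''out'' \<and>
        (\<forall>a\<in>{1..<Suc m}. \<forall>b\<in>{1..<Suc m}.
          snd t ''w'' a b = snd ?u ''w'' a b +
            snd ?u ''w'' a (Suc m) * snd ?u ''w'' (Suc m) b / snd ?u ''s'' 0 0 \<and>
          snd t ''d'' a b = snd ?u ''d'' a b +
            (snd ?u ''d'' a (Suc m) * snd ?u ''w'' (Suc m) b + snd ?u ''w'' a (Suc m) * snd ?u ''d'' (Suc m) b -
              snd ?u ''w'' a (Suc m) * snd ?u ''w'' (Suc m) b * snd ?u ''t'' 0 0 / snd ?u ''s'' 0 0) /
            snd ?u ''s'' 0 0))"
        by (rule runs_mesh_loop[OF u(1,2) less_imp_le[OF l(2)] m(1)[symmetric]]) (use u(5) \<sigma> in simp)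
    next
      fix v assume v: "fst v ''p'' = p \<and> fst v ''l'' = l \<and>
        snd v ''out'' = snd ?u ''out'' \<and>
        (\<forall>a\<in>{1..<Suc m}. \<forall>b\<in>{1..<Suc m}.
          snd v ''w'' a b = snd ?u ''w'' a b +
            snd ?u ''w'' a (Suc m) * snd ?u ''w'' (Suc m) b / snd ?u ''s'' 0 0 \<and>
          snd v ''d'' a b = snd ?u ''d'' a b +
            (snd ?u ''d'' a (Suc m) * snd ?u ''w'' (Suc m) b + snd ?u ''w'' a (Suc m) * snd ?u ''d'' (Suc m) b -
              snd ?u ''w'' a (Suc m) * snd ?u ''w'' (Suc m) b * snd ?u ''t'' 0 0 / snd ?u ''s'' 0 0) /
            snd ?u ''s'' 0 0)"
      have "0 < \<sigma> \<and> elimination_state \<omega> p m (snd v ''w'') (snd v ''d'') (?r + (ln \<sigma> - \<tau> / \<sigma>))"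
        by (rule step) (use v[unfolded u V] in blast)+
      then show "fst v ''p'' = p \<and> fst v ''l'' = l \<and>
        elimination_state \<omega> p (p - l) (snd v ''w'') (snd v ''d'') (snd v ''out'' 0 0)"
        using v u(7) unfolding m_def by metis
    qed (simp_all add: cell_def)
  qed simp
qed

lemma runs_entropy_program:
  assumes \<omega>: "weight_matrix p \<omega>" and p: "1 \<le> p"
  shows "runs entropy_program (input_state p \<omega>) (21 * p ^ 3)
    (\<lambda>t. result t = posterior_entropy p \<omega>)"
proof -
  let ?s = "input_state p \<omega>"
  have w: "snd ?s ''w'' a b = \<omega> a b" if "a \<in> vertices p" "b \<in> vertices p" for a b
    using that by (simp add: input_state_def)
  have s: "fst ?s ''p'' = p" "\<And>a b. snd ?s ''d'' a b = 0" "snd ?s ''out'' 0 0 = 0"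
    by (simp_all add: input_state_def)
  have nn: "0 \<le> snd ?s ''w'' a b" if "a \<in> vertices p" "b \<in> vertices p" for a b
    using w[OF that] sym_nonneg_onD(2)[OF weight_matrix_sym_nonneg[OF \<omega>] that] by simp
  let ?st = "\<lambda>k t. elimination_state \<omega> p k (snd t ''w'') (snd t ''d'') (snd t ''out'' 0 0)"
  let ?N = "2 * p + (4 + 12 * p ^ 2)"
  have p2: "p \<le> p ^ 2" "p ^ 2 \<le> p ^ 3" "p \<le> p ^ 3"
    using p by (simp_all add: self_le_power power_increasing)
  \<comment> \<open>As \<open>p\<close> is at least 1, all lower powers are bounded by
    \<open>p ^ 3\<close>; 21 is \<open>3 + 2 + 4 + 12\<close>.\<close>
  have "(p - 1) * ?N \<le> p * ?N" by simp
  also have "\<dots> = 2 * p ^ 2 + 4 * p + 12 * p ^ 3"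
    by (simp add: power2_eq_square power3_eq_cube algebra_simps)
  finally have cost: "3 * p ^ 2 + (p - 1) * ?N \<le> 21 * p ^ 3" using p2 by linarith
  show ?thesis
    unfolding entropy_program_def
  proof (rule runs_Seq[OF runs_init_loop[OF s(1,2) nn] _ cost])
    fix t assume t: "fst t ''p'' = p \<and> (\<forall>A. A \<noteq> ''d'' \<longrightarrow> snd t A = snd ?s A) \<and>
      (\<forall>a\<in>vertices p. \<forall>b\<in>vertices p. snd t ''d'' a b = snd ?s ''w'' a b * ln (snd ?s ''w'' a b))"
    have "elimination_state \<omega> p p (snd t ''w'') (snd t ''d'') 0"
      by (rule elimination_state_init[OF \<omega> p]) (use t w in auto)
    then have st: "?st p t" using t s(3) by simp
    show "runs (for_loop ''l'' (IVar ''p'') (Seq star_sums (Seq add_log_term mesh_loop))) t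
        ((p - 1) * ?N) (\<lambda>t. result t = posterior_entropy p \<omega>)"
    \<comment> \<open>Round \<open>l\<close> starts with \<open>p + 1 - l\<close> vertices, so the
      exit value \<open>l = p\<close> means that one vertex remains.\<close>
    proof (rule runs_for_loop[where I = "\<lambda>l t. fst t ''p'' = p \<and> fst t ''l'' = l \<and> ?st (p + 1 - l) t"
          and h = p and N = ?N])
      fix l u assume l: "1 \<le> l" "l < p" and u: "fst u ''p'' = p \<and> fst u ''l'' = l \<and> ?st (p + 1 - l) u"
      show "runs (Seq star_sums (Seq add_log_term mesh_loop)) u ?N (\<lambda>t'. fst t' ''l'' = l \<and>
        (fst (iupdate ''l'' (Suc l) t') ''p'' = p \<and> fst (iupdate ''l'' (Suc l) t') ''l'' = Suc l \<and>
          ?st (p + 1 - Suc l) (iupdate ''l'' (Suc l) t')))"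
        by (rule runs_weaken[OF runs_elimination_round[OF _ _ l]]) (use u in auto)
    next
      fix u assume "fst u ''p'' = p \<and> fst u ''l'' = p \<and> ?st (p + 1 - p) u"
      then have "?st 1 u" by simp
      then show "result u = posterior_entropy p \<omega>"
        unfolding result_def by (rule elimination_state_final[OF \<omega> p])
    qed (use t st p in auto)
  qed
qed

theorem proposition6:
  shows "\<exists>c T. computes_with_cost c weight_matrix posterior_entropy T \<and>
    (\<lambda>p. real (T p)) \<in> O(\<lambda>p. real p ^ 3)"
proof (intro exI conjI)
  show "computes_with_cost entropy_program weight_matrix posterior_entropy (\<lambda>p. 21 * p ^ 3)"
    using runs_entropy_program unfolding computes_with_cost_def runs_def by blast
  show "(\<lambda>p. real (21 * p ^ 3)) \<in> O(\<lambda>p. real p ^ 3)"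
    by simp
qed

end
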